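(* Let $f \in L^1([-\pi,\pi])$ be a (complex-valued) function all of whose Fourier coefficients $a_k=\frac{1}{2\pi}\int_{-\pi}^{\pi} f(\theta)e^{-\mathbf{i}k\theta}\,d\theta$, $k\in\mathbb{Z}$, are real. For each positive integer $n$ let $T_n[f]\in\mathbb{R}^{n\times n}$ be the Toeplitz matrix generated by $f$ and let $Y_n\in\mathbb{R}^{n\times n}$ be the anti-identity matrix. Then $$\{Y_nT_n[f]\}_n \sim_{\sigma} f.$$ Moreover, $Y_nT_n[f]$ is (real) symmetric for every $n$, and if $f$ is sparsely vanishing then $$|n^{+}(Y_nT_n[f])-n^{-}(Y_nT_n[f])|=o(n)\quad\text{as } n\to\infty,$$ where $n^{+}(\cdot)$ and $n^{-}(\cdot)$ denote the number of positive and the number of negative eigenvalues of the argument, respectively.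
   Context: Toeplitz matrix: for $f\in L^1([-\pi,\pi])$ with Fourier coefficients $a_k=\frac{1}{2\pi}\int_{-\pi}^{\pi} f(\theta)e^{-\mathbf{i}k\theta}\,d\theta$, the $n\times n$ Toeplitz matrix generated by $f$ is $T_n[f]=(a_{i-j})_{i,j=1}^n$. Anti-identity matrix: $Y_n\in\mathbb{R}^{n\times n}$ has $(i,j)$ entry equal to $1$ if $i+j=n+1$ and $0$ otherwise. Asymptotic singular value distribution: let $C_c(\mathbb{R})$ be the space of complex-valued continuous functions on $\mathbb{R}$ with bounded support. For a sequence of matrices $\{A_n\}_n$ with $A_n$ of size $n\times n$ and singular values $\sigma_1(A_n),\dots,\sigma_n(A_n)$, and a measurable function $f:[-\pi,\pi]\to\mathbb{C}$, one writes $\{A_n\}_n\sim_\sigma f$ if $$\lim_{n\to\infty}\frac1n\sum_{j=1}^n F(\sigma_j(A_n))=\frac{1}{2\pi}\int_{-\pi}^{\pi}F(|f(\theta)|)\,d\theta\quad\text{for all } F\in C_c(\mathbb{R}).$$ Sparsely vanishing function: a measurable function $f$ on $[-\pi,\pi]$ is sparsely vanishing if its set of zeros $\{\theta\in[-\pi,\pi]: f(\theta)=0\}$ has Lebesgue measure zero. Eigenvalues are counted with multiplicity. *)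

theory Defs
  imports
    "HOL-Analysis.Analysis"
    "HOL-Library.Landau_Symbols"
    "HOL-Computational_Algebra.Computational_Algebra"
    "Jordan_Normal_Form.Char_Poly"
    "Jordan_Normal_Form.Schur_Decomposition"
begin

definition fourier_coeff :: "(real \<Rightarrow> complex) \<Rightarrow> int \<Rightarrow> complex" where
  "fourier_coeff f k =
     1 / (2 * of_real pi) *
     (LINT \<theta>:{-pi..pi}|lebesgue. f \<theta> * exp (- \<i> * of_int k * of_real \<theta>))"

definition toeplitz_mat :: "nat \<Rightarrow> (real \<Rightarrow> complex) \<Rightarrow> complex Matrix.mat" where
  "toeplitz_mat n f = Matrix.mat n n (\<lambda>(i, j). fourier_coeff f (int i - int j))"

(* Matrix indices start at 0, so the condition i + j = n + 1 on 1-based indices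
   becomes i + j + 1 = n. *)
definition anti_identity_mat :: "nat \<Rightarrow> complex Matrix.mat" where
  "anti_identity_mat n = Matrix.mat n n (\<lambda>(i, j). if i + j + 1 = n then 1 else 0)"

definition eigenvalues_mset :: "complex Matrix.mat \<Rightarrow> complex multiset" where
  "eigenvalues_mset A = proots (char_poly A)"

(* The eigenvalues of A^* A are real and nonnegative, so Re loses no information. *)
definition singular_values :: "complex Matrix.mat \<Rightarrow> real multiset" where
  "singular_values A = image_mset (\<lambda>z. sqrt (Re z)) (eigenvalues_mset (mat_adjoint A * A))"

definition num_pos_eigenvalues :: "complex Matrix.mat \<Rightarrow> nat" where
  "num_pos_eigenvalues A = size (filter_mset (\<lambda>z. z \<in> \<real> \<and> Re z > 0) (eigenvalues_mset A))"

definition num_neg_eigenvalues :: "complex Matrix.mat \<Rightarrow> nat" where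
  "num_neg_eigenvalues A = size (filter_mset (\<lambda>z. z \<in> \<real> \<and> Re z < 0) (eigenvalues_mset A))"

definition real_symmetric_mat :: "complex Matrix.mat \<Rightarrow> bool" where
  "real_symmetric_mat A \<longleftrightarrow> elements_mat A \<subseteq> \<real> \<and> transpose_mat A = A"

definition continuous_bounded_support :: "(real \<Rightarrow> complex) set" where
  "continuous_bounded_support = {F. continuous_on UNIV F \<and> bounded {x. F x \<noteq> 0}}"

definition sv_distributed :: "(nat \<Rightarrow> complex Matrix.mat) \<Rightarrow> (real \<Rightarrow> complex) \<Rightarrow> bool" where
  "sv_distributed A f \<longleftrightarrow>
     (\<forall>n>0. A n \<in> carrier_mat n n) \<and>
     set_borel_measurable lebesgue {-pi..pi} f \<and>
     (\<forall>F\<in>continuous_bounded_support.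
        (\<lambda>n. 1 / of_nat n * (\<Sum>\<sigma>\<in>#singular_values (A n). F \<sigma>))
          \<longlonglongrightarrow> 1 / (2 * of_real pi) *
             (LINT \<theta>:{-pi..pi}|lebesgue. F (cmod (f \<theta>))))"

definition sparsely_vanishing :: "(real \<Rightarrow> complex) \<Rightarrow> bool" where
  "sparsely_vanishing f \<longleftrightarrow>
     set_borel_measurable lebesgue {-pi..pi} f \<and>
     {\<theta> \<in> {-pi..pi}. f \<theta> = 0} \<in> null_sets lebesgue"

end

theory Submission
  imports Defs "HOL-Probability.Probability"
begin

text \<open>
  The entries of \<open>A\<^sub>n = Y\<^sub>n T\<^sub>n[f]\<close> are \<open>a\<^bsub>n-1-i-l\<^esub>\<close> for indices \<open>i, l\<close> starting at 0.
  They are real and symmetric in \<open>i\<close> and \<open>l\<close>, so \<open>A\<^sub>n\<close> has \<open>n\<close> real eigenvalues, whose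
  absolute values are the singular values. Both asymptotic claims follow from one statement about
  signed eigenvalues: the uniform distribution on the eigenvalues of \<open>A\<^sub>n\<close> converges weakly to the
  law of \<open>\<plusminus>\<bar>f(\<theta>)\<bar>\<close>, where \<open>\<theta>\<close> is uniform on \<open>[-\<pi>,\<pi>]\<close> and the sign is an independent fair coin
  (\<open>empirical_law_weak_conv\<close>). Integrating the even function \<open>F(\<bar>x\<bar>)\<close> gives the singular value
  distribution. If \<open>f\<close> is sparsely vanishing, the limit law has no atom at 0, so the proportions of
  positive and of negative eigenvalues converge to the masses of the two open half lines, and these
  masses are equal by symmetry.

  By Levy's continuity theorem, weak convergence can be tested on characteristic functions, that
  is, on \<open>tr exp(i t A\<^sub>n) / n\<close>. Three ingredients are needed.

  \<^item> Trigonometric polynomials (\<open>trace_moment_bound\<close>). If only the coefficients \<open>a\<^sub>k\<close> with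
    \<open>\<bar>k\<bar> \<le> b\<close> are nonzero, then \<open>A\<^sub>n\<close> lives near the antidiagonal. Its even powers live near the
    diagonal, and away from the corners their diagonal entries equal the mean of \<open>\<bar>f\<bar>\<^sup>k\<close>. Its odd
    powers live near the antidiagonal and meet the diagonal in boundedly many places. Hence
    \<open>tr A\<^sub>n\<^sup>k\<close> is \<open>n\<close> times the \<open>k\<close>-th moment of the limit law, up to a bounded error, and a Taylor
    expansion passes from moments to characteristic functions (\<open>char_tendsto_of_moments\<close>).

  \<^item> Stability (\<open>exp_trace_perturbation\<close>). Interpolating between \<open>exp(i t A)\<close> and \<open>exp(i t B)\<close> by
    \<open>exp(i s A) exp(i (t-s) B)\<close> gives \<open>\<bar>tr exp(i t A) - tr exp(i t B)\<bar> \<le> \<bar>t\<bar> sup \<bar>tr ((A - B) U)\<bar>\<close>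
    over unitary \<open>U\<close>. When \<open>A\<close> and \<open>B\<close> come from \<open>f\<close> and \<open>g\<close>, the difference \<open>A - B\<close> is the average
    over \<open>\<theta>\<close> of \<open>f(\<theta>) - g(\<theta>)\<close> times a rank one matrix built from two vectors of norm \<open>\<surd>n\<close>.
    So the bound is \<open>n \<bar>t\<bar>\<close> times the normalised \<open>L\<^sup>1\<close> distance of \<open>f\<close> and \<open>g\<close>. Division by \<open>n\<close> leaves a
    bound that does not depend on \<open>n\<close>.

  \<^item> Density with real coefficients (\<open>fejer_mean_L1_approx\<close>). The Fejer means of \<open>f\<close> converge to \<open>f\<close>
    in \<open>L\<^sup>1\<close>. Their coefficients are nonnegative multiples of those of \<open>f\<close>, hence real, which keeps the
    approximating matrices symmetric.
\<close>

section \<open>The spectral theorem for Hermitian matrices\<close>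

lemma mat_adjoint_dims [simp]:
  "dim_row (mat_adjoint A) = dim_col A" "dim_col (mat_adjoint A) = dim_row A"
  by (simp_all add: mat_adjoint_def)

lemma mat_adjoint_carrier [simp]: "A \<in> carrier_mat n m \<Longrightarrow> mat_adjoint A \<in> carrier_mat m n"
  by (auto intro!: carrier_matI)

lemma mat_adjoint_index [simp]:
  fixes A :: "complex mat"
  shows "i < dim_col A \<Longrightarrow> j < dim_row A \<Longrightarrow> mat_adjoint A $$ (i, j) = cnj (A $$ (j, i))"
  by (simp add: mat_adjoint_def mat_of_rows_index)

lemma index_mult_mat_sum:
  fixes A :: "complex mat"
  assumes "A \<in> carrier_mat n k" "B \<in> carrier_mat k m" "i < n" "j < m"
  shows "(A * B) $$ (i, j) = (\<Sum>l<k. A $$ (i, l) * B $$ (l, j))"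
  using assms by (auto simp: scalar_prod_def atLeast0LessThan intro!: sum.cong)

lemma mat_adjoint_mult:
  fixes A :: "complex mat"
  assumes "A \<in> carrier_mat n k" "B \<in> carrier_mat k m"
  shows "mat_adjoint (A * B) = mat_adjoint B * mat_adjoint A"
proof (rule eq_matI)
  fix i j assume "i < dim_row (mat_adjoint B * mat_adjoint A)" "j < dim_col (mat_adjoint B * mat_adjoint A)"
  then have ij: "i < m" "j < n" using assms by auto
  show "mat_adjoint (A * B) $$ (i, j) = (mat_adjoint B * mat_adjoint A) $$ (i, j)"
    using assms ij
    by (simp add: index_mult_mat_sum[OF assms] 
        index_mult_mat_sum[OF mat_adjoint_carrier[OF assms(2)] mat_adjoint_carrier[OF assms(1)]]
        mult.commute cnj_sum del: index_mult_mat(1))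
qed (use assms in auto)

lemma mat_adjoint_adjoint [simp]: "mat_adjoint (mat_adjoint A) = (A :: complex mat)"
  by (rule eq_matI) auto

lemma mat_adjoint_four_block_diag:
  fixes A :: "complex mat"
  assumes "A \<in> carrier_mat n n" "B \<in> carrier_mat m m"
  shows "mat_adjoint (four_block_mat A (0\<^sub>m n m) (0\<^sub>m m n) B)
    = four_block_mat (mat_adjoint A) (0\<^sub>m n m) (0\<^sub>m m n) (mat_adjoint B)"
  by (rule eq_matI) (use assms in \<open>auto simp: less_Suc_eq\<close>)

text \<open>The step of the induction below: an eigenvector is completed to a basis, which Gram--Schmidt makes
  orthogonal without moving its first vector. Dividing by the norms makes the columns orthonormal.\<close>
lemma unitary_with_first_column_eigenvector:
  fixes A :: "complex mat"
  assumes A: "A \<in> carrier_mat n n" and n: "n > 0"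
  obtains W e where "W \<in> carrier_mat n n" "mat_adjoint W * W = 1\<^sub>m n"
    "\<And>i. i < n \<Longrightarrow> (A * W) $$ (i, 0) = e * W $$ (i, 0)"
proof -
  have "degree (char_poly A) = n"
    using degree_monic_char_poly[OF A] by simp
  then obtain e where e: "poly (char_poly A) e = 0"
    using fundamental_theorem_of_algebra_alt[of "char_poly A"] n by fastforce
  then have "eigenvalue A e"
    using eigenvalue_root_char_poly[OF A] by simp
  then obtain v where "eigenvector A v e" by (auto simp: eigenvalue_def)
  then have v: "v \<in> carrier_vec n" "v \<noteq> 0\<^sub>v n" "A *\<^sub>v v = e \<cdot>\<^sub>v v"
    using A by (auto simp: eigenvector_def)
  interpret cof_vec_space n "TYPE(complex)" .
  define b where "b = basis_completion v"
  define ws where "ws = gram_schmidt n b"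
  from basis_completion[OF v(1,2), folded b_def]
  have dist_b: "distinct b" and indep: "\<not> lin_dep (set b)" and b: "set b \<subseteq> carrier_vec n"
    and hdb: "hd b = v" and len_b: "length b = n" by auto
  from hdb len_b n obtain vs where bv: "b = v # vs" by (cases b) auto
  from gram_schmidt_result[OF b dist_b indep refl, folded ws_def]
  have ws: "set ws \<subseteq> carrier_vec n" "corthogonal ws" "length ws = n" by (auto simp: len_b)
  from gram_schmidt_hd[OF v(1), of vs, folded bv] have hdws: "hd ws = v" unfolding ws_def .
  have ws0: "ws ! 0 = v" using hdws ws n by (metis hd_conv_nth list.size(3) not_gr_zero)
  define r where "r w = Re (w \<bullet>c w)" for w :: "complex vec"
  have wsi: "ws ! i \<in> carrier_vec n" if "i < n" for i using ws that by auto
  have r: "ws ! i \<bullet>c ws ! i = complex_of_real (r (ws ! i))" "r (ws ! i) > 0" if i: "i < n" for i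
  proof -
    have ge: "ws ! i \<bullet>c ws ! i \<ge> 0" by (rule conjugate_square_ge_0_vec)
    have "ws ! i \<bullet>c ws ! i \<noteq> 0" using corthogonalD[OF ws(2), of i i] i ws by simp
    then show "ws ! i \<bullet>c ws ! i = complex_of_real (r (ws ! i))" "r (ws ! i) > 0"
      using ge by (auto simp: r_def complex_eq_iff less_eq_complex_def)
  qed
  define W where "W = Matrix.mat n n (\<lambda>(i, j). ws ! j $ i / complex_of_real (sqrt (r (ws ! j))))"
  have W: "W \<in> carrier_mat n n" by (simp add: W_def)
  show thesis
  proof (rule that[OF W, of e])
    show "mat_adjoint W * W = 1\<^sub>m n"
    proof (rule eq_matI)
      fix i j assume "i < dim_row (1\<^sub>m n :: complex mat)" "j < dim_col (1\<^sub>m n :: complex mat)"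
      then have ij: "i < n" "j < n" by auto
      have "(mat_adjoint W * W) $$ (i, j) = (\<Sum>l<n. cnj (W $$ (l, i)) * W $$ (l, j))"
        using W ij by (subst index_mult_mat_sum[where n = n and k = n and m = n]) auto
      also have "\<dots> = (\<Sum>l<n. ws ! j $ l * cnj (ws ! i $ l)) 
          / complex_of_real (sqrt (r (ws ! j)) * sqrt (r (ws ! i)))"
        using ij by (simp add: W_def sum_divide_distrib field_simps)
      also have "(\<Sum>l<n. ws ! j $ l * cnj (ws ! i $ l)) = ws ! j \<bullet>c ws ! i"
        using wsi[OF ij(1)] wsi[OF ij(2)] by (auto simp: scalar_prod_def atLeast0LessThan intro!: sum.cong)
      also have "ws ! j \<bullet>c ws ! i = (if i = j then complex_of_real (r (ws ! i)) else 0)"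
        using corthogonalD[OF ws(2), of j i] ij ws r by auto
      also have "\<dots> / complex_of_real (sqrt (r (ws ! j)) * sqrt (r (ws ! i))) = 1\<^sub>m n $$ (i, j)"
        using ij r(2)[OF ij(1)] by (auto simp flip: of_real_mult)
      finally show "(mat_adjoint W * W) $$ (i, j) = 1\<^sub>m n $$ (i, j)" .
    qed (use W in auto)
  next
    fix i assume i: "i < n"
    have "(A * W) $$ (i, 0) = (\<Sum>l<n. A $$ (i, l) * v $ l) / complex_of_real (sqrt (r v))"
      using i n by (subst index_mult_mat_sum[OF A W]) (auto simp: W_def sum_divide_distrib ws0)
    also have "(\<Sum>l<n. A $$ (i, l) * v $ l) = (A *\<^sub>v v) $ i"
      using A v(1) i by (auto simp: scalar_prod_def atLeast0LessThan intro!: sum.cong)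
    also have "\<dots> = e * v $ i" using v i by simp
    finally show "(A * W) $$ (i, 0) = e * W $$ (i, 0)"
      using i n by (simp add: W_def ws0)
  qed
qed

text \<open>Conjugating by the unitary matrix just built makes the first column a multiple of the first unit
  vector. Since the result is still Hermitian, the first row is cleared as well and the eigenvalue is
  real, so the matrix splits into a \<open>1 \<times> 1\<close> block and a smaller Hermitian block.\<close>
lemma hermitian_diagonalization:
  fixes A :: "complex mat"
  assumes "A \<in> carrier_mat n n" "mat_adjoint A = A"
  shows "\<exists>U d. U \<in> carrier_mat n n \<and> mat_adjoint U * U = 1\<^sub>m n \<and>
    A = U * mat_diag n (\<lambda>j. complex_of_real (d j)) * mat_adjoint U"
  using assms
proof (induction n arbitrary: A)
  case 0
  then show ?case by (intro exI[of _ "1\<^sub>m 0"]) (auto intro!: eq_matI)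
next
  case (Suc n A)
  note A = Suc.prems(1)
  obtain W e where W: "W \<in> carrier_mat (Suc n) (Suc n)" "mat_adjoint W * W = 1\<^sub>m (Suc n)"
    and AW: "\<And>i. i < Suc n \<Longrightarrow> (A * W) $$ (i, 0) = e * W $$ (i, 0)"
    using unitary_with_first_column_eigenvector[OF A] by auto
  note aW = mat_adjoint_carrier[OF W(1)]
  have W': "W * mat_adjoint W = 1\<^sub>m (Suc n)"
    using mat_mult_left_right_inverse[OF aW W(1) W(2)] .
  define B where "B = mat_adjoint W * (A * W)"
  have B: "B \<in> carrier_mat (Suc n) (Suc n)" unfolding B_def by (rule mult_carrier_mat[OF aW mult_carrier_mat[OF A W(1)]])
  have Bh: "mat_adjoint B = B"
    unfolding B_def using W(1) A Suc.prems(2)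
    by (simp add: mat_adjoint_mult[of _ "Suc n" "Suc n" _ "Suc n"] assoc_mult_mat[of _ "Suc n" "Suc n" _ "Suc n" _ "Suc n"])
  have B0: "B $$ (i, 0) = (if i = 0 then e else 0)" if i: "i < Suc n" for i
  proof -
    have "B $$ (i, 0) = (\<Sum>l<Suc n. mat_adjoint W $$ (i, l) * (A * W) $$ (l, 0))"
      unfolding B_def using W A i by (subst index_mult_mat_sum[where n = "Suc n" and k = "Suc n" and m = "Suc n"]) auto
    also have "\<dots> = e * (\<Sum>l<Suc n. mat_adjoint W $$ (i, l) * W $$ (l, 0))"
      unfolding sum_distrib_left by (intro sum.cong refl) (simp add: AW del: index_mult_mat(1))
    also have "(\<Sum>l<Suc n. mat_adjoint W $$ (i, l) * W $$ (l, 0)) = (mat_adjoint W * W) $$ (i, 0)"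
      using W i by (subst index_mult_mat_sum[where n = "Suc n" and k = "Suc n" and m = "Suc n"]) auto
    finally show ?thesis using i by (simp add: W(2))
  qed
  have B0': "B $$ (0, i) = (if i = 0 then e else 0)" if i: "i < Suc n" for i
  proof -
    have "B $$ (0, i) = cnj (B $$ (i, 0))" using Bh B i mat_adjoint_index[of 0 B i] by simp
    moreover have "B $$ (0, 0) = cnj (B $$ (0, 0))" using Bh B mat_adjoint_index[of 0 B 0] by simp
    ultimately show ?thesis using B0[OF i] B0[of 0] by auto
  qed
  have er: "e = complex_of_real (Re e)"
    using Bh B mat_adjoint_index[of 0 B 0] B0[of 0] by (simp add: complex_eq_iff)
  define C where "C = Matrix.mat n n (\<lambda>(i, j). B $$ (Suc i, Suc j))"
  have C: "C \<in> carrier_mat n n" by (simp add: C_def)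
  have "mat_adjoint C = C"
  proof (rule eq_matI)
    fix i j assume "i < dim_row C" "j < dim_col C"
    then show "mat_adjoint C $$ (i, j) = C $$ (i, j)"
      using mat_adjoint_index[of "Suc i" B "Suc j"] B Bh by (simp add: C_def)
  qed (simp_all add: C_def)
  from Suc.IH[OF C this] obtain P \<mu> where P: "P \<in> carrier_mat n n" "mat_adjoint P * P = 1\<^sub>m n"
    and CP: "C = P * mat_diag n (\<lambda>j. complex_of_real (\<mu> j)) * mat_adjoint P" by blast
  define D where "D = mat_diag n (\<lambda>j. complex_of_real (\<mu> j))"
  define E where "E = mat_diag 1 (\<lambda>_. e)"
  define F where "F = four_block_mat (1\<^sub>m 1) (0\<^sub>m 1 n) (0\<^sub>m n 1) P"
  define d where "d = (\<lambda>j. case j of 0 \<Rightarrow> Re e | Suc j \<Rightarrow> \<mu> j)"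
  define D' where "D' = four_block_mat E (0\<^sub>m 1 n) (0\<^sub>m n 1) D"
  have D: "D \<in> carrier_mat n n" "E \<in> carrier_mat 1 1" by (simp_all add: D_def E_def)
  have D': "D' = mat_diag (Suc n) (\<lambda>j. complex_of_real (d j))"
    unfolding D'_def using er
    by (intro eq_matI) (auto simp: D_def E_def d_def mat_diag_def split: nat.split)
  have one: "mat_adjoint (1\<^sub>m 1) = (1\<^sub>m 1 :: complex mat)"
    by (rule eq_matI) auto
  have Fc: "F \<in> carrier_mat (Suc n) (Suc n)" using P by (auto simp: F_def)
  have aF: "mat_adjoint F = four_block_mat (1\<^sub>m 1) (0\<^sub>m 1 n) (0\<^sub>m n 1) (mat_adjoint P)"
    unfolding F_def by (subst mat_adjoint_four_block_diag) (use P one in auto)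
  have FF: "mat_adjoint F * F = 1\<^sub>m (Suc n)"
    unfolding aF unfolding F_def
    apply (subst mult_four_block_mat[of _ 1 1 _ n _ n _ _ 1 _ n])
    using P by auto
  have Dc: "D' \<in> carrier_mat (Suc n) (Suc n)" using D by (auto simp: D'_def)
  have "B = four_block_mat E (0\<^sub>m 1 n) (0\<^sub>m n 1) C"
  proof (rule eq_matI)
    fix i j assume "i < dim_row (four_block_mat E (0\<^sub>m 1 n) (0\<^sub>m n 1) C)" "j < dim_col (four_block_mat E (0\<^sub>m 1 n) (0\<^sub>m n 1) C)"
    then have "i < Suc n" "j < Suc n" using D C by auto
    then show "B $$ (i, j) = four_block_mat E (0\<^sub>m 1 n) (0\<^sub>m n 1) C $$ (i, j)"
      using D C B0[of i] B0'[of j] by (cases i; cases j) (auto simp: C_def E_def mat_diag_def)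
  qed (use D C B in auto)
  also have "\<dots> = F * D' * mat_adjoint F"
  proof -
    have "F * D' = four_block_mat E (0\<^sub>m 1 n) (0\<^sub>m n 1) (P * D)"
      unfolding F_def D'_def by (subst mult_four_block_mat[of _ 1 1 _ n _ n _ _ 1 _ n]) (use P D in auto)
    also have "\<dots> * mat_adjoint F = four_block_mat E (0\<^sub>m 1 n) (0\<^sub>m n 1) (P * D * mat_adjoint P)"
      unfolding aF by (subst mult_four_block_mat[of _ 1 1 _ n _ n _ _ 1 _ n]) (use P D in auto)
    finally show ?thesis by (simp add: CP D_def)
  qed
  finally have BF: "B = F * D' * mat_adjoint F" .
  define U where "U = W * F"
  have U: "U \<in> carrier_mat (Suc n) (Suc n)" using W Fc by (simp add: U_def)
  note assoc = assoc_mult_mat[of _ "Suc n" "Suc n" _ "Suc n" _ "Suc n"]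
  have aU: "mat_adjoint U = mat_adjoint F * mat_adjoint W"
    unfolding U_def by (rule mat_adjoint_mult[OF W(1) Fc])
  have "mat_adjoint U * U = mat_adjoint F * (mat_adjoint W * W) * F"
  proof -
    have "(Y * X) * (W * F) = Y * (X * W) * F"
      if "X \<in> carrier_mat (Suc n) (Suc n)" "Y \<in> carrier_mat (Suc n) (Suc n)" for X Y
      using that W(1) Fc by (simp add: assoc)
    from this[OF aW mat_adjoint_carrier[OF Fc]] show ?thesis unfolding aU unfolding U_def .
  qed
  also have "\<dots> = 1\<^sub>m (Suc n)" using W(2) Fc FF by simp
  finally have UU: "mat_adjoint U * U = 1\<^sub>m (Suc n)" .
  have "W * B * mat_adjoint W = (W * mat_adjoint W) * A * (W * mat_adjoint W)"
  proof -
    have "W * (X * (A * W)) * X = (W * X) * A * (W * X)" if "X \<in> carrier_mat (Suc n) (Suc n)" for X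
      using that W(1) A by (simp add: assoc)
    from this[OF aW] show ?thesis unfolding B_def .
  qed
  also have "\<dots> = A" using A W' by simp
  finally have "A = W * B * mat_adjoint W" by simp
  also have "\<dots> = U * D' * mat_adjoint U"
  proof -
    have "W * (F * D' * Y) * X = W * F * D' * (Y * X)"
      if "X \<in> carrier_mat (Suc n) (Suc n)" "Y \<in> carrier_mat (Suc n) (Suc n)" for X Y
      using that W(1) Fc Dc by (simp add: assoc)
    from this[OF aW mat_adjoint_carrier[OF Fc]] show ?thesis unfolding BF aU unfolding U_def .
  qed
  finally show ?case using U UU D' by blast
qed

lemma proots_prod_linear: "proots (\<Prod>a\<leftarrow>as. [:- a, 1:]) = mset (as :: complex list)"
proof (induction as)
  case (Cons a as)
  have "(\<Prod>a\<leftarrow>as. [:- a, 1:]) \<noteq> 0" by (auto simp: prod_list_zero_iff)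
  then show ?case using Cons by (simp add: proots_mult del: mult_pCons_left)
qed simp

lemma eigenvalues_mset_unitary_diag:
  assumes U: "U \<in> carrier_mat n n" "mat_adjoint U * U = 1\<^sub>m n"
    and A: "A = U * mat_diag n d * mat_adjoint U"
  shows "eigenvalues_mset A = image_mset d (mset_set {..<n})"
proof -
  have U': "U * mat_adjoint U = 1\<^sub>m n"
    using mat_mult_left_right_inverse[OF mat_adjoint_carrier[OF U(1)] U] .
  have "similar_mat A (mat_diag n d)"
    by (rule similar_matI[of _ _ U "mat_adjoint U" n]) (use U U' A in auto)
  then have "char_poly A = char_poly (mat_diag n d)" by (rule char_poly_similar)
  also have "\<dots> = (\<Prod>a \<leftarrow> diag_mat (mat_diag n d). [:- a, 1:])"
    by (rule char_poly_upper_triangular[where n = n]) (auto simp: mat_diag_def)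
  also have "diag_mat (mat_diag n d) = map d [0..<n]"
    by (auto simp: diag_mat_def mat_diag_def)
  finally show ?thesis
    by (simp add: eigenvalues_mset_def proots_prod_linear mset_map atLeast0LessThan del: map_map)
qed

text \<open>Eigenvalues \<open>d j\<close> and an orthonormal basis of eigenvectors \<open>q j\<close> of the array \<open>a\<close>, with \<open>q j i\<close> the
  \<open>i\<close>-th coordinate of \<open>q j\<close>. From here on all linear algebra consists of finite sums, which exchange
  with integrals more readily than matrix products do.\<close>
definition spectral_decomposition ::
  "nat \<Rightarrow> (nat \<Rightarrow> nat \<Rightarrow> complex) \<Rightarrow> (nat \<Rightarrow> real) \<Rightarrow> (nat \<Rightarrow> nat \<Rightarrow> complex) \<Rightarrow> bool" where
  "spectral_decomposition n a d q \<longleftrightarrow>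
     (\<forall>j<n. \<forall>k<n. (\<Sum>i<n. cnj (q j i) * q k i) = of_bool (j = k)) \<and>
     (\<forall>i<n. \<forall>l<n. (\<Sum>j<n. q j i * cnj (q j l)) = of_bool (i = l)) \<and>
     (\<forall>i<n. \<forall>l<n. a i l = (\<Sum>j<n. of_real (d j) * q j i * cnj (q j l)))"

text \<open>For Hermitian \<open>A\<close> with diagonalization \<open>U D U\<^sup>*\<close> one has \<open>A\<^sup>* A = U D\<^sup>2 U\<^sup>*\<close>, which is why the singular
  values are the absolute values of the eigenvalues, multiplicities included.\<close>
lemma hermitian_spectral_decomposition:
  fixes A :: "complex mat"
  assumes A: "A \<in> carrier_mat n n" "mat_adjoint A = A"
  obtains d q where "spectral_decomposition n (\<lambda>i l. A $$ (i, l)) d q"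
    "eigenvalues_mset A = image_mset (\<lambda>j. of_real (d j)) (mset_set {..<n})"
    "singular_values A = image_mset (\<lambda>j. \<bar>d j\<bar>) (mset_set {..<n})"
proof -
  obtain U d where U: "U \<in> carrier_mat n n" "mat_adjoint U * U = 1\<^sub>m n"
    and AU: "A = U * mat_diag n (\<lambda>j. complex_of_real (d j)) * mat_adjoint U"
    using hermitian_diagonalization[OF A] by auto
  note aU = mat_adjoint_carrier[OF U(1)]
  define D where "D = mat_diag n (\<lambda>j. complex_of_real (d j))"
  have D: "D \<in> carrier_mat n n" by (simp add: D_def)
  have U': "U * mat_adjoint U = 1\<^sub>m n"
    using mat_mult_left_right_inverse[OF aU U] .
  define q where "q j i = U $$ (i, j)" for i j
  show thesis
  proof (rule that)
    show "spectral_decomposition n (\<lambda>i l. A $$ (i, l)) d q"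
      unfolding spectral_decomposition_def
    proof (intro conjI allI impI)
      fix j k assume jk: "j < n" "k < n"
      have "(\<Sum>i<n. cnj (q j i) * q k i) = (mat_adjoint U * U) $$ (j, k)"
        using jk U(1) by (subst index_mult_mat_sum[OF aU U(1)]) (auto simp: q_def)
      then show "(\<Sum>i<n. cnj (q j i) * q k i) = of_bool (j = k)" using jk U by simp
    next
      fix i l assume il: "i < n" "l < n"
      have "(\<Sum>j<n. q j i * cnj (q j l)) = (U * mat_adjoint U) $$ (i, l)"
        using il U(1) by (subst index_mult_mat_sum[OF U(1) aU]) (auto simp: q_def)
      then show "(\<Sum>j<n. q j i * cnj (q j l)) = of_bool (i = l)" using il U' by simp
      have "A $$ (i, l) = (\<Sum>j<n. (U * D) $$ (i, j) * mat_adjoint U $$ (j, l))"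
        unfolding AU D_def[symmetric]
        using il D U(1) by (subst index_mult_mat_sum[OF mult_carrier_mat[OF U(1) D] aU]) auto
      also have "\<dots> = (\<Sum>j<n. of_real (d j) * q j i * cnj (q j l))"
        using il U(1) by (intro sum.cong refl) (simp add: D_def mat_diag_mult_right[OF U(1)] q_def)
      finally show "A $$ (i, l) = (\<Sum>j<n. of_real (d j) * q j i * cnj (q j l))" .
    qed
    show "eigenvalues_mset A = image_mset (\<lambda>j. of_real (d j)) (mset_set {..<n})"
      by (rule eigenvalues_mset_unitary_diag[OF U AU])
    note assoc = assoc_mult_mat[of _ n n _ n _ n]
    have "mat_adjoint A * A = U * D * (mat_adjoint U * U) * D * mat_adjoint U"
    proof -
      have "(U * D * V) * (U * D * V) = U * D * (V * U) * D * V" if "V \<in> carrier_mat n n" for V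
        using that U(1) D by (simp add: assoc)
      from this[OF aU] show ?thesis unfolding A(2) by (simp add: AU D_def[symmetric])
    qed
    also have "\<dots> = U * (D * D) * mat_adjoint U"
      unfolding U(2) using U(1) aU D by (simp add: assoc)
    also have "D * D = mat_diag n (\<lambda>j. complex_of_real ((d j)\<^sup>2))"
      by (simp add: D_def power2_eq_square)
    finally have "eigenvalues_mset (mat_adjoint A * A)
        = image_mset (\<lambda>j. complex_of_real ((d j)\<^sup>2)) (mset_set {..<n})"
      by (rule eigenvalues_mset_unitary_diag[OF U])
    then show "singular_values A = image_mset (\<lambda>j. \<bar>d j\<bar>) (mset_set {..<n})"
      by (simp add: singular_values_def image_mset.compositionality o_def)
  qed
qed

section \<open>Stability of exponential traces\<close>

lemma parseval_sum:
  fixes Q :: "nat \<Rightarrow> nat \<Rightarrow> complex"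
  assumes Q: "\<And>i l. i < n \<Longrightarrow> l < n \<Longrightarrow> (\<Sum>j<n. Q j i * cnj (Q j l)) = of_bool (i = l)"
  shows "(\<Sum>j<n. (cmod (\<Sum>i<n. Q j i * u i))\<^sup>2) = (\<Sum>i<n. (cmod (u i))\<^sup>2)"
proof -
  have "complex_of_real (\<Sum>j<n. (cmod (\<Sum>i<n. Q j i * u i))\<^sup>2)
      = (\<Sum>j<n. (\<Sum>i<n. Q j i * u i) * (\<Sum>l<n. cnj (Q j l) * cnj (u l)))"
    by (simp only: of_real_sum complex_norm_square cnj_sum complex_cnj_mult)
  also have "\<dots> = (\<Sum>j<n. \<Sum>i<n. \<Sum>l<n. Q j i * cnj (Q j l) * (u i * cnj (u l)))"
    by (simp add: sum_product mult_ac)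
  also have "\<dots> = (\<Sum>i<n. \<Sum>l<n. \<Sum>j<n. Q j i * cnj (Q j l) * (u i * cnj (u l)))"
    by (subst sum.swap, rule sum.cong[OF refl], rule sum.swap)
  also have "\<dots> = (\<Sum>i<n. \<Sum>l<n. of_bool (i = l) * (u i * cnj (u l)))"
    by (intro sum.cong refl) (simp add: Q flip: sum_distrib_right)
  also have "\<dots> = (\<Sum>i<n. u i * cnj (u i))"
    by (intro sum.cong refl) (simp add: of_bool_def if_distrib[of "\<lambda>z. z * _"] cong: if_cong)
  also have "\<dots> = complex_of_real (\<Sum>i<n. (cmod (u i))\<^sup>2)"
    by (simp only: of_real_sum complex_norm_square)
  finally show ?thesis by (simp only: of_real_eq_iff)
qed

lemma spectral_decompositionD:
  assumes "spectral_decomposition n a d q"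
  shows "j < n \<Longrightarrow> k < n \<Longrightarrow> (\<Sum>i<n. cnj (q j i) * q k i) = of_bool (j = k)"
    and "i < n \<Longrightarrow> l < n \<Longrightarrow> (\<Sum>j<n. q j i * cnj (q j l)) = of_bool (i = l)"
    and "i < n \<Longrightarrow> l < n \<Longrightarrow> a i l = (\<Sum>j<n. of_real (d j) * q j i * cnj (q j l))"
  using assms by (auto simp: spectral_decomposition_def)

lemma spectral_decompositionD':
  assumes "spectral_decomposition n a d q"
  shows "j < n \<Longrightarrow> k < n \<Longrightarrow> (\<Sum>i<n. q j i * cnj (q k i)) = of_bool (j = k)"
    and "i < n \<Longrightarrow> l < n \<Longrightarrow> (\<Sum>j<n. cnj (q j i) * q j l) = of_bool (i = l)"
  using spectral_decompositionD(1)[OF assms, of k j] spectral_decompositionD(2)[OF assms, of l i]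
  by (simp_all only: mult.commute[of "cnj _"] eq_commute[of j k] eq_commute[of i l])

lemma spectral_right_eigenvector:
  assumes a: "spectral_decomposition n a d q" and "k < n" "i < n"
  shows "(\<Sum>l<n. a i l * q k l) = of_real (d k) * q k i"
proof -
  have "(\<Sum>l<n. a i l * q k l) = (\<Sum>l<n. \<Sum>j<n. of_real (d j) * q j i * (cnj (q j l) * q k l))"
    using assms by (simp add: spectral_decompositionD(3)[OF a] sum_distrib_right mult.assoc)
  also have "\<dots> = (\<Sum>j<n. of_real (d j) * q j i * of_bool (j = k))"
    by (subst sum.swap) (use assms in \<open>simp add: spectral_decompositionD(1)[OF a] flip: sum_distrib_left\<close>)
  also have "\<dots> = of_real (d k) * q k i"
    using assms by (simp add: of_bool_def if_distrib cong: if_cong)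
  finally show ?thesis .
qed

lemma spectral_left_eigenvector:
  assumes a: "spectral_decomposition n a d q" and "k < n" "l < n"
  shows "(\<Sum>i<n. cnj (q k i) * a i l) = of_real (d k) * cnj (q k l)"
proof -
  have "(\<Sum>i<n. cnj (q k i) * a i l) = (\<Sum>i<n. \<Sum>j<n. of_real (d j) * cnj (q j l) * (cnj (q k i) * q j i))"
    using assms by (simp add: spectral_decompositionD(3)[OF a] sum_distrib_left mult_ac)
  also have "\<dots> = (\<Sum>j<n. of_real (d j) * cnj (q j l) * of_bool (k = j))"
    by (subst sum.swap) (use assms in \<open>simp add: spectral_decompositionD(1)[OF a] flip: sum_distrib_left\<close>)
  also have "\<dots> = of_real (d k) * cnj (q k l)"
    using assms by (simp add: of_bool_def if_distrib cong: if_cong)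
  finally show ?thesis .
qed

text \<open>Think of \<open>a\<close> and \<open>b\<close> as Hermitian matrices and of \<open>x j\<close>, \<open>y k\<close> as the eigenvalues of unitary functions
  \<open>X\<close> of \<open>a\<close> and \<open>Z\<close> of \<open>b\<close>. The double sum is then \<open>v\<^sup>T Z X u\<close>, written out in the two eigenbases. Unitary
  matrices preserve the norm, so it is at most \<open>\<bar>u\<bar> \<bar>v\<bar> = n\<close>.\<close>
lemma rank_one_bilinear_bound:
  fixes u v x y :: "nat \<Rightarrow> complex"
  assumes a: "spectral_decomposition n a d q" and b: "spectral_decomposition n b e r"
    and x: "\<And>j. cmod (x j) = 1" and y: "\<And>k. cmod (y k) = 1"
    and u: "\<And>i. cmod (u i) = 1" and v: "\<And>i. cmod (v i) = 1"
  shows "cmod (\<Sum>j<n. \<Sum>k<n. x j * y k * cnj (\<Sum>i<n. cnj (q j i) * r k i) *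
      ((\<Sum>i<n. cnj (q j i) * u i) * (\<Sum>l<n. r k l * v l))) \<le> n"
proof -
  define \<alpha> where "\<alpha> j = x j * (\<Sum>i<n. cnj (q j i) * u i)" for j
  define \<beta> where "\<beta> k = y k * (\<Sum>l<n. r k l * v l)" for k
  define A where "A i = (\<Sum>j<n. q j i * \<alpha> j)" for i
  define B where "B i = (\<Sum>k<n. cnj (r k i) * \<beta> k)" for i
  have "(\<Sum>j<n. \<Sum>k<n. x j * y k * cnj (\<Sum>i<n. cnj (q j i) * r k i) *
      ((\<Sum>i<n. cnj (q j i) * u i) * (\<Sum>l<n. r k l * v l)))
    = (\<Sum>j<n. \<Sum>k<n. \<Sum>i<n. (q j i * \<alpha> j) * (cnj (r k i) * \<beta> k))"
  proof (intro sum.cong refl)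
    fix j k
    have "x j * y k * cnj (\<Sum>i<n. cnj (q j i) * r k i) * ((\<Sum>i<n. cnj (q j i) * u i) * (\<Sum>l<n. r k l * v l))
        = (\<Sum>i<n. q j i * cnj (r k i)) * (\<alpha> j * \<beta> k)"
      by (simp add: \<alpha>_def \<beta>_def)
    also have "\<dots> = (\<Sum>i<n. (q j i * \<alpha> j) * (cnj (r k i) * \<beta> k))"
      unfolding sum_distrib_right by (simp add: mult_ac)
    finally show "x j * y k * cnj (\<Sum>i<n. cnj (q j i) * r k i) * ((\<Sum>i<n. cnj (q j i) * u i) * (\<Sum>l<n. r k l * v l))
        = (\<Sum>i<n. (q j i * \<alpha> j) * (cnj (r k i) * \<beta> k))" .
  qed
  also have "\<dots> = (\<Sum>j<n. \<Sum>i<n. \<Sum>k<n. (q j i * \<alpha> j) * (cnj (r k i) * \<beta> k))"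
    by (intro sum.cong refl sum.swap)
  also have "\<dots> = (\<Sum>i<n. A i * B i)"
    by (subst sum.swap) (simp add: A_def B_def sum_product)
  finally have eq: "(\<Sum>j<n. \<Sum>k<n. x j * y k * cnj (\<Sum>i<n. cnj (q j i) * r k i) *
      ((\<Sum>i<n. cnj (q j i) * u i) * (\<Sum>l<n. r k l * v l))) = (\<Sum>i<n. A i * B i)" .
  have "(\<Sum>i<n. (cmod (A i))\<^sup>2) = (\<Sum>j<n. (cmod (\<alpha> j))\<^sup>2)"
    unfolding A_def using spectral_decompositionD'(1)[OF a]
    by (intro parseval_sum[where Q = "\<lambda>i j. q j i"]) simp
  also have "\<dots> = (\<Sum>j<n. (cmod (\<Sum>i<n. cnj (q j i) * u i))\<^sup>2)"
    by (simp add: \<alpha>_def norm_mult x)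
  also have "\<dots> = (\<Sum>i<n. (cmod (u i))\<^sup>2)"
    using spectral_decompositionD'(2)[OF a] by (intro parseval_sum) simp
  finally have A: "(\<Sum>i<n. (cmod (A i))\<^sup>2) = n" by (simp add: u)
  have "(\<Sum>i<n. (cmod (B i))\<^sup>2) = (\<Sum>k<n. (cmod (\<beta> k))\<^sup>2)"
    unfolding B_def using spectral_decompositionD(1)[OF b] 
    by (intro parseval_sum[where Q = "\<lambda>i j. cnj (r j i)"]) simp
  also have "\<dots> = (\<Sum>k<n. (cmod (\<Sum>l<n. r k l * v l))\<^sup>2)"
    by (simp add: \<beta>_def norm_mult y)
  also have "\<dots> = (\<Sum>i<n. (cmod (v i))\<^sup>2)"
    using spectral_decompositionD(2)[OF b] by (intro parseval_sum) simp
  finally have B: "(\<Sum>i<n. (cmod (B i))\<^sup>2) = n" by (simp add: v)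
  have "cmod (\<Sum>i<n. A i * B i) \<le> (\<Sum>i<n. ((cmod (A i))\<^sup>2 + (cmod (B i))\<^sup>2) / 2)"
  proof (rule sum_norm_le)
    fix i
    have "2 * cmod (A i) * cmod (B i) \<le> (cmod (A i))\<^sup>2 + (cmod (B i))\<^sup>2"
      by (rule sum_squares_bound)
    then show "cmod (A i * B i) \<le> ((cmod (A i))\<^sup>2 + (cmod (B i))\<^sup>2) / 2"
      by (simp add: norm_mult)
  qed
  also have "\<dots> = n"
    by (simp add: sum_divide_distrib[symmetric] sum.distrib A B)
  finally show ?thesis by (simp only: eq)
qed

text \<open>Here \<open>a - b\<close> is an average of rank one matrices with weight \<open>h\<close>. The rank one bound is applied under
  the integral sign, so only the \<open>L\<^sup>1\<close> norm of \<open>h\<close> enters.\<close>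
lemma difference_bilinear_bound:
  fixes x y :: "nat \<Rightarrow> complex" and h :: "'m \<Rightarrow> complex"
  assumes a: "spectral_decomposition n a d q" and b: "spectral_decomposition n b e r"
    and x: "\<And>j. cmod (x j) = 1" and y: "\<And>k. cmod (y k) = 1"
    and u: "\<And>\<theta> i. cmod (u i \<theta>) = 1" and v: "\<And>\<theta> i. cmod (v i \<theta>) = 1"
    and um: "\<And>i. u i \<in> borel_measurable M" and vm: "\<And>i. v i \<in> borel_measurable M"
    and h: "integrable M h"
    and ab: "\<And>i l. i < n \<Longrightarrow> l < n \<Longrightarrow> a i l - b i l = (LINT \<theta>|M. h \<theta> * (u i \<theta> * v l \<theta>))"
  shows "cmod (\<Sum>j<n. \<Sum>k<n. x j * y k * cnj (\<Sum>i<n. cnj (q j i) * r k i) *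
      (\<Sum>i<n. \<Sum>l<n. cnj (q j i) * (a i l - b i l) * r k l)) \<le> n * (LINT \<theta>|M. cmod (h \<theta>))"
proof -
  define g where "g \<theta> = (\<Sum>j<n. \<Sum>k<n. x j * y k * cnj (\<Sum>i<n. cnj (q j i) * r k i) *
      ((\<Sum>i<n. cnj (q j i) * u i \<theta>) * (\<Sum>l<n. r k l * v l \<theta>)))" for \<theta>
  have g: "cmod (g \<theta>) \<le> n" for \<theta>
    unfolding g_def by (rule rank_one_bilinear_bound[OF a b x y u v])
  have [measurable]: "h \<in> borel_measurable M" using h by simp
  note um[measurable] vm[measurable]
  have int: "integrable M (\<lambda>\<theta>. h \<theta> * (u i \<theta> * v l \<theta>))" for i l
    using h by (rule Bochner_Integration.integrable_bound) (auto simp: norm_mult u v)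
  have gm: "g \<in> borel_measurable M" unfolding g_def by measurable
  have hg: "integrable M (\<lambda>\<theta>. h \<theta> * g \<theta>)"
  proof (rule Bochner_Integration.integrable_bound)
    show "integrable M (\<lambda>\<theta>. of_nat n * h \<theta>)" using h by simp
    show "AE \<theta> in M. cmod (h \<theta> * g \<theta>) \<le> cmod (of_nat n * h \<theta>)"
      using g by (auto simp: norm_mult mult.commute intro!: mult_right_mono)
  qed (use gm in measurable)
  have "(\<Sum>j<n. \<Sum>k<n. x j * y k * cnj (\<Sum>i<n. cnj (q j i) * r k i) *
      (\<Sum>i<n. \<Sum>l<n. cnj (q j i) * (a i l - b i l) * r k l))
     = (\<Sum>j<n. \<Sum>k<n. x j * y k * cnj (\<Sum>i<n. cnj (q j i) * r k i) *
      (\<Sum>i<n. \<Sum>l<n. cnj (q j i) * (LINT \<theta>|M. h \<theta> * (u i \<theta> * v l \<theta>)) * r k l))"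
    by (simp add: ab)
  also have "\<dots> = (LINT \<theta>|M. (\<Sum>j<n. \<Sum>k<n. x j * y k * cnj (\<Sum>i<n. cnj (q j i) * r k i) *
      (\<Sum>i<n. \<Sum>l<n. cnj (q j i) * (h \<theta> * (u i \<theta> * v l \<theta>)) * r k l)))"
    using int by (simp del: cnj_sum)
  also have "\<dots> = (LINT \<theta>|M. h \<theta> * g \<theta>)"
    by (intro Bochner_Integration.integral_cong refl)
       (simp add: g_def sum_distrib_left sum_product mult_ac del: cnj_sum)
  finally have eq: "(\<Sum>j<n. \<Sum>k<n. x j * y k * cnj (\<Sum>i<n. cnj (q j i) * r k i) *
      (\<Sum>i<n. \<Sum>l<n. cnj (q j i) * (a i l - b i l) * r k l)) = (LINT \<theta>|M. h \<theta> * g \<theta>)" .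
  have "cmod (LINT \<theta>|M. h \<theta> * g \<theta>) \<le> (LINT \<theta>|M. cmod (h \<theta> * g \<theta>))"
    by (rule integral_norm_bound)
  also have "\<dots> \<le> (LINT \<theta>|M. n * cmod (h \<theta>))"
    by (rule integral_mono[OF integrable_norm[OF hg]])
       (use g h in \<open>auto simp: norm_mult mult.commute intro!: mult_right_mono\<close>)
  finally have "cmod (LINT \<theta>|M. h \<theta> * g \<theta>) \<le> (LINT \<theta>|M. n * cmod (h \<theta>))" .
  then show ?thesis unfolding eq by simp
qed

text \<open>With \<open>w j k\<close> the inner products of the two eigenbases, \<open>\<psi> s\<close> below is
  \<open>tr (exp(i s a) exp(i (t - s) b))\<close>, which joins the two traces. Its derivative is
  \<open>i tr (exp(i s a) (a - b) exp(i (t - s) b))\<close>, because \<open>(d j - e k) w j k\<close> is the entry of \<open>a - b\<close>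
  between the two eigenvectors. The mean value inequality along the real axis concludes.\<close>
lemma exp_trace_perturbation:
  fixes h :: "'m \<Rightarrow> complex"
  assumes a: "spectral_decomposition n a d q" and b: "spectral_decomposition n b e r"
    and u: "\<And>\<theta> i. cmod (u i \<theta>) = 1" and v: "\<And>\<theta> i. cmod (v i \<theta>) = 1"
    and um: "\<And>i. u i \<in> borel_measurable M" and vm: "\<And>i. v i \<in> borel_measurable M"
    and h: "integrable M h"
    and ab: "\<And>i l. i < n \<Longrightarrow> l < n \<Longrightarrow> a i l - b i l = (LINT \<theta>|M. h \<theta> * (u i \<theta> * v l \<theta>))"
  shows "cmod ((\<Sum>j<n. iexp (t * d j)) - (\<Sum>k<n. iexp (t * e k))) \<le> \<bar>t\<bar> * (n * (LINT \<theta>|M. cmod (h \<theta>)))"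
proof -
  define w where "w j k = (\<Sum>i<n. cnj (q j i) * r k i)" for j k
  define \<psi> where "\<psi> s = (\<Sum>j<n. \<Sum>k<n. w j k * cnj (w j k) * exp (\<i> * (s * d j + (of_real t - s) * e k)))" for s :: complex
  define \<psi>' where "\<psi>' s = (\<Sum>j<n. \<Sum>k<n. w j k * cnj (w j k) * (\<i> * (of_real (d j) - of_real (e k)) * exp (\<i> * (s * d j + (of_real t - s) * e k))))" for s :: complex
  have w: "(\<Sum>i<n. \<Sum>l<n. cnj (q j i) * (a i l - b i l) * r k l) = (of_real (d j) - of_real (e k)) * w j k"
    if jk: "j < n" "k < n" for j k
  proof -
    have "(\<Sum>i<n. \<Sum>l<n. cnj (q j i) * (a i l - b i l) * r k l)
      = (\<Sum>i<n. \<Sum>l<n. cnj (q j i) * a i l * r k l) - (\<Sum>i<n. \<Sum>l<n. cnj (q j i) * (b i l * r k l))"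
      by (simp add: sum_subtractf algebra_simps)
    also have "(\<Sum>i<n. \<Sum>l<n. cnj (q j i) * a i l * r k l) = (\<Sum>l<n. (\<Sum>i<n. cnj (q j i) * a i l) * r k l)"
      by (subst sum.swap) (simp add: sum_distrib_right)
    also have "(\<Sum>i<n. \<Sum>l<n. cnj (q j i) * (b i l * r k l)) = (\<Sum>i<n. cnj (q j i) * (\<Sum>l<n. b i l * r k l))"
      by (simp add: sum_distrib_left)
    also have "(\<Sum>l<n. (\<Sum>i<n. cnj (q j i) * a i l) * r k l) - (\<Sum>i<n. cnj (q j i) * (\<Sum>l<n. b i l * r k l))
      = (\<Sum>l<n. of_real (d j) * cnj (q j l) * r k l) - (\<Sum>i<n. cnj (q j i) * (of_real (e k) * r k i))"
      using jk by (simp add: spectral_left_eigenvector[OF a] spectral_right_eigenvector[OF b])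
    also have "\<dots> = (of_real (d j) - of_real (e k)) * w j k"
      by (simp add: w_def sum_distrib_left sum_subtractf algebra_simps)
    finally show ?thesis .
  qed
  have der: "(\<psi> has_field_derivative \<psi>' s) (at s within X)" for s X
    unfolding \<psi>_def \<psi>'_def by (auto intro!: derivative_eq_intros sum.cong simp: algebra_simps)
  have bound: "cmod (\<psi>' s) \<le> n * (LINT \<theta>|M. cmod (h \<theta>))" if s: "s \<in> \<real>" for s
  proof -
    obtain s' where s': "s = of_real s'" using s by (auto elim: Reals_cases)
    have "\<psi>' s = \<i> * (\<Sum>j<n. \<Sum>k<n. iexp (s' * d j) * iexp ((t - s') * e k) * cnj (w j k) * ((of_real (d j) - of_real (e k)) * w j k))"
      unfolding \<psi>'_def s' by (simp add: sum_distrib_left exp_add[symmetric] algebra_simps)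
    also have "\<dots> = \<i> * (\<Sum>j<n. \<Sum>k<n. iexp (s' * d j) * iexp ((t - s') * e k) * cnj (w j k) *
         (\<Sum>i<n. \<Sum>l<n. cnj (q j i) * (a i l - b i l) * r k l))"
      by (simp add: w)
    also have "cmod \<dots> \<le> n * (LINT \<theta>|M. cmod (h \<theta>))"
      unfolding norm_mult w_def norm_ii mult_1
      by (rule difference_bilinear_bound[OF a b _ _ u v um vm h ab]) auto
    finally show ?thesis .
  qed
  have "cmod (\<psi> (of_real t) - \<psi> 0) \<le> n * (LINT \<theta>|M. cmod (h \<theta>)) * cmod (of_real t - 0)"
    by (rule field_differentiable_bound[of "\<real>" \<psi> \<psi>']) (auto simp: der bound convex_Reals)
  moreover have "\<psi> (of_real t) = (\<Sum>j<n. iexp (t * d j))"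
  proof -
    have "(\<Sum>k<n. w j k * cnj (w j k)) = 1" if "j < n" for j
    proof -
      have "(\<Sum>k<n. (cmod (\<Sum>i<n. r k i * cnj (q j i)))\<^sup>2) = (\<Sum>i<n. (cmod (cnj (q j i)))\<^sup>2)"
        using spectral_decompositionD(2)[OF b] by (intro parseval_sum) simp
      moreover have "complex_of_real (\<Sum>i<n. (cmod (cnj (q j i)))\<^sup>2) = 1"
        using spectral_decompositionD(1)[OF a that that]
        by (simp only: of_real_sum complex_norm_square complex_cnj_cnj) simp
      ultimately have "complex_of_real (\<Sum>k<n. (cmod (w j k))\<^sup>2) = 1" by (simp add: w_def mult.commute)
      then show ?thesis by (simp only: of_real_sum complex_norm_square)
    qed
    then show ?thesis by (simp add: \<psi>_def mult.commute flip: sum_distrib_right)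
  qed
  moreover have "\<psi> 0 = (\<Sum>k<n. iexp (t * e k))"
  proof -
    have *: "(\<Sum>j<n. w j k * cnj (w j k)) = 1" if "k < n" for k
    proof -
      have "(\<Sum>j<n. (cmod (\<Sum>i<n. cnj (q j i) * r k i))\<^sup>2) = (\<Sum>i<n. (cmod (r k i))\<^sup>2)"
        using spectral_decompositionD'(2)[OF a] by (intro parseval_sum) simp
      moreover have "complex_of_real (\<Sum>i<n. (cmod (r k i))\<^sup>2) = 1"
        using spectral_decompositionD'(1)[OF b that that]
        by (simp only: of_real_sum complex_norm_square) simp
      ultimately have "complex_of_real (\<Sum>j<n. (cmod (w j k))\<^sup>2) = 1" by (simp add: w_def)
      then show ?thesis by (simp only: of_real_sum complex_norm_square)
    qed
    show ?thesis unfolding \<psi>_def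
      by (subst sum.swap) (simp add: * flip: sum_distrib_right)
  qed
  ultimately show ?thesis by (simp add: mult.commute)
qed

section \<open>Fourier coefficients on the interval\<close>

text \<open>The interval \<open>[-\<pi>,\<pi>]\<close> with Lebesgue measure stands for the circle. Its total mass is \<open>2\<pi>\<close>, and the
  normalisation is made explicit where a probability measure is wanted.\<close>
abbreviation circle :: "real measure" where "circle \<equiv> lebesgue_on {-pi..pi}"

lemma space_circle [simp]: "space circle = {-pi..pi}"
  by (simp add: space_restrict_space)

lemma measure_circle: "measure circle (space circle) = 2 * pi"
  by (simp add: measure_restrict_space)

lemma finite_measure_circle: "finite_measure circle"
  by (rule finite_measureI) (simp add: emeasure_restrict_space)

interpretation circle: finite_measure circle
  by (rule finite_measure_circle)

lemma continuous_measurable_circle: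
  fixes g :: "real \<Rightarrow> 'a :: euclidean_space"
  shows "continuous_on UNIV g \<Longrightarrow> g \<in> borel_measurable circle"
  by (rule continuous_imp_measurable_on_sets_lebesgue) (auto intro: continuous_on_subset)

lemma continuous_integrable_circle:
  fixes g :: "real \<Rightarrow> complex"
  assumes g: "continuous_on UNIV g"
  shows "integrable circle g"
proof -
  have "compact (g ` {-pi..pi})"
    by (intro compact_continuous_image continuous_on_subset[OF g]) auto
  then obtain B where "\<And>x. x \<in> {-pi..pi} \<Longrightarrow> norm (g x) \<le> B"
    by (meson bounded_iff compact_imp_bounded image_eqI)
  then show ?thesis
    by (intro circle.integrable_const_bound[of _ B] AE_I2 continuous_measurable_circle g) auto
qed

lemma fourier_coeff_circle:
  "fourier_coeff f k = 1 / (2 * of_real pi) * (LINT \<theta>|circle. f \<theta> * exp (- \<i> * of_int k * of_real \<theta>))"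
  unfolding fourier_coeff_def set_lebesgue_integral_def
  by (subst integral_restrict_space) (auto simp: mult_ac)

text \<open>Orthogonality of the exponentials, by integrating an explicit antiderivative.\<close>
lemma fourier_coeff_const_1: "fourier_coeff (\<lambda>_. 1) k = of_bool (k = 0)"
proof (cases "k = 0")
  case True
  then show ?thesis using measure_circle by (simp add: fourier_coeff_circle scaleR_conv_of_real)
next
  case False
  define F where "F \<theta> = exp (- \<i> * of_int k * of_real \<theta>) / (- \<i> * of_int k)" for \<theta> :: real
  have "(F has_vector_derivative exp (- \<i> * of_int k * of_real x)) (at x within {-pi..pi})" for x
    unfolding F_def using False
    by (auto intro!: derivative_eq_intros has_vector_derivative_real_field simp: field_simps)
  then have "((\<lambda>\<theta>. exp (- \<i> * of_int k * of_real \<theta>)) has_integral (F pi - F (- pi))) {-pi..pi}"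
    by (intro fundamental_theorem_of_calculus) auto
  moreover have "F pi = F (- pi)"
  proof -
    have "exp (- \<i> * of_int k * of_real pi) = exp (- \<i> * of_int k * of_real (- pi))"
      unfolding exp_eq by (rule exI[of _ "-k"]) (simp add: algebra_simps)
    then show ?thesis by (simp add: F_def)
  qed
  moreover have "integrable circle (\<lambda>\<theta>. exp (- \<i> * of_int k * of_real \<theta>))"
    by (intro continuous_integrable_circle continuous_intros)
  ultimately show ?thesis using False
    by (simp add: fourier_coeff_circle lebesgue_integral_eq_integral integral_unique)
qed

section \<open>Traces of powers of banded Hankel matrices\<close>

text \<open>Entries of the Toeplitz matrix with its rows in reverse order: a Hankel matrix.\<close>
definition hankel_entry :: "(int \<Rightarrow> complex) \<Rightarrow> nat \<Rightarrow> nat \<Rightarrow> nat \<Rightarrow> complex" where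
  "hankel_entry a n i l = a (int n - 1 - int i - int l)"

text \<open>Powers of the \<open>n \<times> n\<close> matrix with entries \<open>A i l\<close>, multiplied from the left so that an induction
  follows the first factor of a product.\<close>
fun entry_power :: "nat \<Rightarrow> (nat \<Rightarrow> nat \<Rightarrow> complex) \<Rightarrow> nat \<Rightarrow> nat \<Rightarrow> nat \<Rightarrow> complex" where
  "entry_power n A 0 i l = of_bool (i = l)"
| "entry_power n A (Suc k) i l = (\<Sum>u<n. A i u * entry_power n A k u l)"

lemma entry_power_spectral:
  assumes a: "spectral_decomposition n A d q" and "i < n" "l < n"
  shows "entry_power n A k i l = (\<Sum>j<n. of_real (d j) ^ k * q j i * cnj (q j l))"
  using assms(2,3)
proof (induction k arbitrary: i)
  case 0
  then show ?case using spectral_decompositionD(2)[OF a] by simp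
next
  case (Suc k)
  have "entry_power n A (Suc k) i l = (\<Sum>u<n. \<Sum>j<n. of_real (d j) ^ k * cnj (q j l) * (A i u * q j u))"
    using Suc by (simp add: sum_distrib_left mult_ac)
  also have "\<dots> = (\<Sum>j<n. of_real (d j) ^ k * cnj (q j l) * (of_real (d j) * q j i))"
    by (subst sum.swap) (simp add: spectral_right_eigenvector[OF a] Suc.prems flip: sum_distrib_left)
  finally show ?case by (simp add: mult_ac)
qed

lemma trace_entry_power:
  assumes a: "spectral_decomposition n A d q"
  shows "(\<Sum>i<n. entry_power n A k i i) = of_real (\<Sum>j<n. d j ^ k)"
proof -
  have "(\<Sum>i<n. entry_power n A k i i) = (\<Sum>i<n. \<Sum>j<n. of_real (d j) ^ k * (q j i * cnj (q j i)))"
    by (simp add: entry_power_spectral[OF a] mult.assoc)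
  also have "\<dots> = (\<Sum>j<n. of_real (d j) ^ k)"
    by (subst sum.swap) (simp add: spectral_decompositionD'(1)[OF a] flip: sum_distrib_left)
  finally show ?thesis by simp
qed

text \<open>Coefficients of a trigonometric polynomial of degree at most \<open>b\<close>.\<close>
locale band =
  fixes a :: "int \<Rightarrow> complex" and b :: nat
  assumes band: "\<And>k. \<bar>k\<bar> > int b \<Longrightarrow> a k = 0"
begin

lemma band_support: "a k \<noteq> 0 \<Longrightarrow> \<bar>k\<bar> \<le> int b"
  using band[of k] by linarith

text \<open>The Wiener norm of the coefficients. It bounds the row sums of the matrices and the trigonometric
  polynomial itself, and thus serves as the geometric rate for the moments on both sides.\<close>
definition coeff_norm :: real where "coeff_norm = (\<Sum>k\<in>{- int b..int b}. cmod (a k))"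

lemma coeff_norm_nonneg: "coeff_norm \<ge> 0" by (simp add: coeff_norm_def sum_nonneg)

text \<open>A row that is at distance at least \<open>b\<close> from the corners contains the whole band, so that the sum no
  longer depends on \<open>n\<close>.\<close>
lemma band_sum_interior:
  assumes "int b \<le> c" "c < int n - int b"
  shows "(\<Sum>u<n. a (c - int u) * g u) = (\<Sum>s\<in>{- int b..int b}. a s * g (nat (c - s)))"
proof -
  have "(\<Sum>u<n. a (c - int u) * g u) = (\<Sum>u\<in>{u. u < n \<and> \<bar>c - int u\<bar> \<le> int b}. a (c - int u) * g u)"
    by (rule sum.mono_neutral_right) (auto dest: band_support)
  also have "\<dots> = (\<Sum>s\<in>{- int b..int b}. a s * g (nat (c - s)))"
    by (rule sum.reindex_bij_witness[of _ "\<lambda>s. nat (c - s)" "\<lambda>u. c - int u"]) (use assms in auto)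
  finally show ?thesis .
qed

lemma hankel_row_sum: "(\<Sum>u<n. cmod (hankel_entry a n i u)) \<le> coeff_norm"
proof -
  have "(\<Sum>u<n. cmod (hankel_entry a n i u)) = (\<Sum>u\<in>{u. u < n \<and> \<bar>int n - 1 - int i - int u\<bar> \<le> int b}. cmod (hankel_entry a n i u))"
    by (rule sum.mono_neutral_right) (auto simp: hankel_entry_def dest: band_support)
  also have "\<dots> = (\<Sum>s\<in>(\<lambda>u. int n - 1 - int i - int u) ` {u. u < n \<and> \<bar>int n - 1 - int i - int u\<bar> \<le> int b}. cmod (a s))"
    by (subst sum.reindex) (auto simp: inj_on_def hankel_entry_def)
  also have "\<dots> \<le> coeff_norm"
    unfolding coeff_norm_def by (rule sum_mono2) auto
  finally show ?thesis .
qed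

lemma entry_power_bound: "cmod (entry_power n (hankel_entry a n) k i l) \<le> coeff_norm ^ k"
proof (induction k arbitrary: i)
  case (Suc k)
  have "cmod (entry_power n (hankel_entry a n) (Suc k) i l) \<le> (\<Sum>u<n. cmod (hankel_entry a n i u) * coeff_norm ^ k)"
    unfolding entry_power.simps
    by (intro sum_norm_le) (auto simp: norm_mult intro!: mult_left_mono Suc)
  also have "\<dots> \<le> coeff_norm * coeff_norm ^ k"
    unfolding sum_distrib_right[symmetric] by (intro mult_right_mono hankel_row_sum) (simp add: coeff_norm_nonneg)
  finally show ?case by simp
qed auto

text \<open>Each factor reflects an index about the centre and then moves it by at most \<open>b\<close>. An even number of
  reflections cancels, an odd number leaves one.\<close>
lemma entry_power_band:
  assumes "l < n" "i < n" 
  shows "(even k \<longrightarrow> \<bar>int i - int l\<bar> > int k * int b \<longrightarrow> entry_power n (hankel_entry a n) k i l = 0) \<and>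
   (odd k \<longrightarrow> \<bar>int n - 1 - int i - int l\<bar> > int k * int b \<longrightarrow> entry_power n (hankel_entry a n) k i l = 0)"
  using assms(2)
proof (induction k arbitrary: i)
  case (Suc k)
  have *: "hankel_entry a n i u * entry_power n (hankel_entry a n) k u l = 0"
    if u: "u < n" and far: "\<bar>if even k then int n - 1 - int i - int l else int i - int l\<bar> > int (Suc k) * int b" for u
  proof (cases "\<bar>int n - 1 - int i - int u\<bar> > int b")
    case True
    then show ?thesis by (simp add: hankel_entry_def band)
  next
    case False
    have "entry_power n (hankel_entry a n) k u l = 0"
      using Suc.IH[OF u] False far by (cases "even k") (auto simp: algebra_simps split: if_splits)
    then show ?thesis by simp
  qed
  then show ?case by (auto intro!: sum.neutral)
qed auto

definition symbol :: "real \<Rightarrow> complex" where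
  "symbol \<theta> = (\<Sum>k\<in>{- int b..int b}. a k * exp (\<i> * of_int k * of_real \<theta>))"

lemma continuous_symbol: "continuous_on A symbol"
  unfolding symbol_def by (intro continuous_intros)

definition even_moment_coeff :: "nat \<Rightarrow> int \<Rightarrow> complex" where
  "even_moment_coeff m = fourier_coeff (\<lambda>\<theta>. of_real (cmod (symbol \<theta>) ^ (2 * m)))"

text \<open>Since the coefficients are real, \<open>\<bar>p\<bar>\<^sup>2\<close> is the product of \<open>p(\<theta>)\<close> and \<open>p(-\<theta>)\<close>. Expanding it turns
  multiplication by \<open>\<bar>p\<bar>\<^sup>2\<close> into a double shift of the Fourier coefficients.\<close>
lemma even_moment_coeff_Suc:
  assumes real: "\<And>k. a k \<in> \<real>"
  shows "even_moment_coeff (Suc m) e = (\<Sum>s\<in>{- int b..int b}. a s * (\<Sum>r\<in>{- int b..int b}. a r * even_moment_coeff m (e + s - r)))"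
proof -
  have cnj_symbol: "cnj (symbol \<theta>) = (\<Sum>s\<in>{- int b..int b}. a s * exp (- \<i> * of_int s * of_real \<theta>))" for \<theta>
    using real by (simp add: symbol_def cnj_sum exp_cnj Reals_cnj_iff)
  have pw: "of_real (cmod (symbol \<theta>) ^ (2 * Suc m)) * exp (- \<i> * of_int e * of_real \<theta>)
     = (\<Sum>s\<in>{- int b..int b}. \<Sum>r\<in>{- int b..int b}. a s * a r * 
         (of_real (cmod (symbol \<theta>) ^ (2 * m)) * exp (- \<i> * of_int (e + s - r) * of_real \<theta>)))" for \<theta>
  proof -
    have "complex_of_real (cmod (symbol \<theta>) ^ (2 * Suc m)) = of_real (cmod (symbol \<theta>) ^ (2 * m)) * (cnj (symbol \<theta>) * symbol \<theta>)"
      by (simp add: power2_eq_square[symmetric] complex_norm_square[symmetric] mult.commute[of "cnj _"])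
    also have "cnj (symbol \<theta>) * symbol \<theta> = (\<Sum>s\<in>{- int b..int b}. \<Sum>r\<in>{- int b..int b}. 
          a s * a r * exp (\<i> * of_int (r - s) * of_real \<theta>))"
      unfolding cnj_symbol unfolding symbol_def sum_product
      by (intro sum.cong refl) (simp add: algebra_simps exp_diff exp_minus field_simps)
    finally show ?thesis
      by (simp add: sum_distrib_left sum_distrib_right mult_ac)
         (intro sum.cong refl, simp add: mult_ac exp_add[symmetric] algebra_simps)
  qed
  have int: "integrable circle (\<lambda>\<theta>. of_real (cmod (symbol \<theta>) ^ (2 * m)) * exp (- \<i> * of_int j * of_real \<theta>))" for j
    by (intro continuous_integrable_circle continuous_intros continuous_symbol)
  define J where "J j = (LINT \<theta>|circle. of_real (cmod (symbol \<theta>) ^ (2 * m)) * exp (- \<i> * of_int j * of_real \<theta>))" for j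
  have "even_moment_coeff (Suc m) e = 1 / (2 * of_real pi) *
      (\<Sum>s\<in>{- int b..int b}. \<Sum>r\<in>{- int b..int b}. a s * a r * J (e + s - r))"
    unfolding even_moment_coeff_def fourier_coeff_circle pw J_def
    by (simp only: Bochner_Integration.integral_sum Bochner_Integration.integrable_sum
        integrable_mult_right int integral_mult_right_zero)
  moreover have "even_moment_coeff m j = 1 / (2 * of_real pi) * J j" for j
    by (simp add: even_moment_coeff_def fourier_coeff_circle J_def)
  ultimately show ?thesis
    by (simp add: sum_distrib_left mult_ac)
qed

text \<open>Two consecutive factors act on interior rows by the same double shift as multiplication by \<open>\<bar>p\<bar>\<^sup>2\<close>
  acts on Fourier coefficients, so that the even powers coincide there with the Toeplitz matrices of
  \<open>\<bar>p\<bar>\<^bsup>2m\<^esup>\<close>. Each step may consume rows up to distance \<open>2b\<close> from the corners.\<close>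
lemma entry_power_interior:
  assumes real: "\<And>k. a k \<in> \<real>"
    and "l < n" "2 * m * b \<le> i" "i + 2 * m * b < n"
  shows "entry_power n (hankel_entry a n) (2 * m) i l = even_moment_coeff m (int i - int l)"
  using assms(3,4)
proof (induction m arbitrary: i)
  case 0
  then show ?case by (simp add: even_moment_coeff_def fourier_coeff_const_1)
next
  case (Suc m)
  let ?E = "entry_power n (hankel_entry a n)"
  let ?I = "{- int b..int b}"
  have i: "2 * int m * int b + 2 * int b \<le> int i" "int i + 2 * int m * int b + 2 * int b < int n"
  proof -
    have "int (2 * Suc m * b) \<le> int i" "int (i + 2 * Suc m * b) < int n"
      using Suc.prems by (simp_all only: of_nat_le_iff of_nat_less_iff)
    then show "2 * int m * int b + 2 * int b \<le> int i" "int i + 2 * int m * int b + 2 * int b < int n"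
      by (simp_all add: algebra_simps)
  qed
  have mb: "0 \<le> int m * int b" by simp
  have bnd: "- int b \<le> s" "s \<le> int b" if "s \<in> ?I" for s using that by auto
  have "?E (2 * Suc m) i l = (\<Sum>u<n. a (int n - 1 - int i - int u) * ?E (Suc (2 * m)) u l)"
    by (simp add: hankel_entry_def)
  also have "\<dots> = (\<Sum>s\<in>?I. a s * ?E (Suc (2 * m)) (nat (int n - 1 - int i - s)) l)"
    by (rule band_sum_interior) (use i mb in linarith)+
  also have "\<dots> = (\<Sum>s\<in>?I. a s * (\<Sum>r\<in>?I. a r * even_moment_coeff m (int i - int l + s - r)))"
  proof (intro sum.cong refl arg_cong2[where f = "(*)"])
    fix s assume s: "s \<in> ?I"
    have "?E (Suc (2 * m)) (nat (int n - 1 - int i - s)) l = (\<Sum>v<n. a (int i + s - int v) * ?E (2 * m) v l)"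
    proof -
      have "int (nat (int n - 1 - int i - s)) = int n - 1 - int i - s"
      proof (rule nat_0_le)
        have "s \<le> int b" using s by simp
        then show "0 \<le> int n - 1 - int i - s" using i mb by linarith
      qed
      then show ?thesis by (simp add: hankel_entry_def)
    qed
    also have "\<dots> = (\<Sum>r\<in>?I. a r * ?E (2 * m) (nat (int i + s - r)) l)"
      by (rule band_sum_interior) (use i bnd[OF s] mb in linarith)+
    also have "\<dots> = (\<Sum>r\<in>?I. a r * even_moment_coeff m (int i - int l + s - r))"
    proof (intro sum.cong refl arg_cong2[where f = "(*)"])
      fix r assume r: "r \<in> ?I"
      define v where "v = nat (int i + s - r)"
      have v: "int v = int i + s - r" unfolding v_def by (rule nat_0_le) (use bnd[OF s] bnd[OF r] i mb in linarith)
      have "int (2 * m * b) \<le> int v" "int (v + 2 * m * b) < int n"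
        using v s r i by (auto simp: algebra_simps)
      then have "2 * m * b \<le> v" "v + 2 * m * b < n" by (simp_all only: of_nat_le_iff of_nat_less_iff)
      from Suc.IH[OF this] show "?E (2 * m) (nat (int i + s - r)) l = even_moment_coeff m (int i - int l + s - r)"
        unfolding v_def[symmetric] v by (simp add: algebra_simps)
    qed
    finally show "?E (Suc (2 * m)) (nat (int n - 1 - int i - s)) l
       = (\<Sum>r\<in>?I. a r * even_moment_coeff m (int i - int l + s - r))" .
  qed
  also have "\<dots> = even_moment_coeff (Suc m) (int i - int l)"
    by (rule even_moment_coeff_Suc[OF real, symmetric])
  finally show ?case .
qed

text \<open>The moments of the limit law. The odd ones vanish because that law is symmetric.\<close>
definition moment :: "nat \<Rightarrow> complex" where
  "moment k = (if even k then even_moment_coeff (k div 2) 0 else 0)"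

text \<open>Diagonal entries differ from the moment only at the \<open>kb\<close> first and \<open>kb\<close> last places if \<open>k\<close> is
  even, and only within distance \<open>kb/2\<close> of the centre if \<open>k\<close> is odd. In both cases there are at most
  \<open>2kb + 1\<close> exceptions, whatever \<open>n\<close> is.\<close>
lemma trace_moment_bound:
  assumes real: "\<And>k. a k \<in> \<real>"
  shows "cmod ((\<Sum>i<n. entry_power n (hankel_entry a n) k i i) - of_nat n * moment k)
     \<le> (2 * real (k * b) + 1) * (coeff_norm ^ k + cmod (moment k))"
proof -
  let ?E = "entry_power n (hankel_entry a n)"
  \<comment> \<open>The exceptional diagonal places. In the odd case the moment is 0, and a nonzero entry forces \<open>i\<close> close to its own reflection \<open>n - 1 - i\<close>.\<close>
  define Bad where "Bad = {i. i < n \<and> ?E k i i \<noteq> moment k}"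
  have card: "card Bad \<le> 2 * (k * b) + 1"
  proof (cases "even k")
    case True
    then obtain m where k: "k = 2 * m" by (elim evenE)
    have "Bad \<subseteq> {..<k * b} \<union> {n - k * b..<n}"
    proof
      fix i assume i: "i \<in> Bad"
      show "i \<in> {..<k * b} \<union> {n - k * b..<n}"
      proof (rule ccontr)
        assume "i \<notin> {..<k * b} \<union> {n - k * b..<n}"
        then have "2 * m * b \<le> i" "i + 2 * m * b < n" "i < n" using i by (auto simp: k Bad_def)
        then show False using i entry_power_interior[OF real, of i n m i] by (simp add: Bad_def moment_def k)
      qed
    qed
    then have "card Bad \<le> card ({..<k * b} \<union> {n - k * b..<n})" by (intro card_mono) auto
    also have "\<dots> \<le> k * b + k * b" by (rule order_trans[OF card_Un_le]) simp
    finally show ?thesis by simp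
  next
    case False
    have "(\<lambda>i. int n - 1 - 2 * int i) ` Bad \<subseteq> {- int (k * b)..int (k * b)}"
    proof safe
      fix i assume i: "i \<in> Bad"
      then have "\<not> \<bar>int n - 1 - int i - int i\<bar> > int k * int b"
        using entry_power_band[of i n i k] False by (auto simp: Bad_def moment_def)
      then show "int n - 1 - 2 * int i \<in> {- int (k * b)..int (k * b)}" by auto
    qed
    then have "card ((\<lambda>i. int n - 1 - 2 * int i) ` Bad) \<le> card {- int (k * b)..int (k * b)}"
      by (intro card_mono) auto
    moreover have "card ((\<lambda>i. int n - 1 - 2 * int i) ` Bad) = card Bad"
      by (intro card_image) (auto simp: inj_on_def)
    ultimately show ?thesis by (simp add: nat_add_distrib nat_mult_distrib mult.commute)
  qed
  have "(\<Sum>i<n. ?E k i i) - of_nat n * moment k = (\<Sum>i<n. ?E k i i - moment k)"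
    by (simp add: sum_subtractf)
  also have "\<dots> = (\<Sum>i\<in>Bad. ?E k i i - moment k)"
    by (rule sum.mono_neutral_right) (auto simp: Bad_def)
  also have "cmod \<dots> \<le> (\<Sum>i\<in>Bad. coeff_norm ^ k + cmod (moment k))"
    by (intro sum_norm_le order_trans[OF norm_triangle_ineq4] add_right_mono entry_power_bound)
  also have "\<dots> = real (card Bad) * (coeff_norm ^ k + cmod (moment k))" by simp
  also have "\<dots> \<le> (2 * real (k * b) + 1) * (coeff_norm ^ k + cmod (moment k))"
    using card by (intro mult_right_mono) (auto simp: coeff_norm_nonneg simp flip: of_nat_mult)
  finally show ?thesis .
qed

end

section \<open>Density of trigonometric polynomials in the space of integrable functions\<close>

inductive trig_poly :: "(real \<Rightarrow> complex) \<Rightarrow> bool" where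
  monomial: "trig_poly (\<lambda>\<theta>. c * exp (\<i> * of_int k * of_real \<theta>))"
| add: "trig_poly f \<Longrightarrow> trig_poly g \<Longrightarrow> trig_poly (\<lambda>\<theta>. f \<theta> + g \<theta>)"

lemma trig_poly_continuous: "trig_poly f \<Longrightarrow> continuous_on A f"
  by (induction rule: trig_poly.induct) (intro continuous_intros; assumption)+

lemma trig_poly_mult:
  assumes "trig_poly f" "trig_poly g"
  shows "trig_poly (\<lambda>\<theta>. f \<theta> * g \<theta>)"
  using assms(1)
proof (induction rule: trig_poly.induct)
  case (monomial c k)
  show ?case using assms(2)
  proof (induction rule: trig_poly.induct)
    case (monomial d l)
    have "(\<lambda>\<theta>. c * exp (\<i> * of_int k * of_real \<theta>) * (d * exp (\<i> * of_int l * of_real \<theta>)))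
      = (\<lambda>\<theta>. (c * d) * exp (\<i> * of_int (k + l) * of_real \<theta>))"
      by (simp add: fun_eq_iff distrib_left distrib_right exp_add mult_ac)
    then show ?case by (simp only: trig_poly.monomial)
  next
    case (add f g)
    then show ?case using trig_poly.add[OF add.IH] by (simp add: distrib_left)
  qed
next
  case (add f g)
  then show ?case using trig_poly.add[OF add.IH] by (simp add: distrib_right)
qed

lemma trig_poly_const: "trig_poly (\<lambda>_. c)"
  using trig_poly.monomial[of c 0] by simp

text \<open>On the unit circle a real linear form is a combination of \<open>cos \<theta>\<close> and \<open>sin \<theta>\<close>. This starts the
  induction that turns polynomials in the plane into trigonometric polynomials.\<close>
lemma trig_poly_real_polynomial_cis:
  fixes p :: "complex \<Rightarrow> real"
  assumes "real_polynomial_function p"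
  shows "trig_poly (\<lambda>\<theta>. of_real (p (cis \<theta>)))"
  using assms
proof (induction rule: real_polynomial_function.induct)
  case (linear f)
  have "f (cis \<theta>) = cos \<theta> * f 1 + sin \<theta> * f \<i>" for \<theta>
  proof -
    have "cis \<theta> = cos \<theta> *\<^sub>R 1 + sin \<theta> *\<^sub>R \<i>" by (simp add: complex_eq_iff)
    then show ?thesis using bounded_linear.linear[OF linear] by (simp add: linear_add linear_scale)
  qed
  then have "(\<lambda>\<theta>. complex_of_real (f (cis \<theta>))) = 
      (\<lambda>\<theta>. ((f 1 - \<i> * f \<i>) / 2) * exp (\<i> * of_int 1 * of_real \<theta>) + ((f 1 + \<i> * f \<i>) / 2) * exp (\<i> * of_int (- 1) * of_real \<theta>))"
    by (simp add: fun_eq_iff complex_eq_iff Re_exp Im_exp field_simps)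
  then show ?case by (simp only: trig_poly.intros)
next
  case (const c)
  then show ?case by (rule trig_poly_const)
next
  case (add f g)
  then show ?case using trig_poly.add by simp
next
  case (mult f g)
  then show ?case using trig_poly_mult by simp
qed

lemma trig_poly_uniform_approx:
  fixes h :: "complex \<Rightarrow> complex"
  assumes "continuous_on (sphere 0 1) h" "\<epsilon> > 0"
  obtains g where "trig_poly g" "\<And>\<theta>. cmod (h (cis \<theta>) - g \<theta>) < \<epsilon>"
proof -
  obtain p where p: "polynomial_function p" "\<And>z. z \<in> sphere 0 1 \<Longrightarrow> cmod (h z - p z) < \<epsilon>"
    using Stone_Weierstrass_polynomial_function[OF compact_sphere assms] by blast
  have "real_polynomial_function (Re \<circ> p)" "real_polynomial_function (Im \<circ> p)"
    using p(1) by (auto simp: polynomial_function_def bounded_linear_Re bounded_linear_Im)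
  then have "trig_poly (\<lambda>\<theta>. of_real ((Re \<circ> p) (cis \<theta>)) + \<i> * of_real ((Im \<circ> p) (cis \<theta>)))"
    by (intro trig_poly.add trig_poly_mult trig_poly_const trig_poly_real_polynomial_cis)
  moreover have "(\<lambda>\<theta>. of_real ((Re \<circ> p) (cis \<theta>)) + \<i> * of_real ((Im \<circ> p) (cis \<theta>))) = (\<lambda>\<theta>. p (cis \<theta>))"
    by (simp add: complex_eq_iff fun_eq_iff)
  ultimately have "trig_poly (\<lambda>\<theta>. p (cis \<theta>))" by simp
  then show thesis using that p(2) by simp
qed

text \<open>Membership in the \<open>L\<^sup>1\<close> closure of the trigonometric polynomials.\<close>
definition trig_approximable :: "(real \<Rightarrow> complex) \<Rightarrow> bool" where
  "trig_approximable f \<longleftrightarrow> integrable circle f \<and>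
     (\<forall>\<epsilon>>0. \<exists>g. trig_poly g \<and> (LINT \<theta>|circle. cmod (f \<theta> - g \<theta>)) < \<epsilon>)"

lemma integrable_trig_poly: "trig_poly g \<Longrightarrow> integrable circle g"
  by (intro continuous_integrable_circle trig_poly_continuous)

lemma L1_triangle:
  fixes f g h :: "'m \<Rightarrow> complex"
  assumes "integrable M f" "integrable M g" "integrable M h"
  shows "(LINT \<theta>|M. cmod (f \<theta> - h \<theta>)) \<le> (LINT \<theta>|M. cmod (f \<theta> - g \<theta>)) + (LINT \<theta>|M. cmod (g \<theta> - h \<theta>))"
proof -
  have "cmod (f x - h x) \<le> cmod (f x - g x) + cmod (g x - h x)" for x
    using norm_triangle_ineq[of "f x - g x" "g x - h x"] by simp
  then have "(LINT \<theta>|M. cmod (f \<theta> - h \<theta>)) \<le> (LINT \<theta>|M. cmod (f \<theta> - g \<theta>) + cmod (g \<theta> - h \<theta>))"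
    using assms by (intro integral_mono Bochner_Integration.integrable_add integrable_norm Bochner_Integration.integrable_diff) simp_all
  also have "\<dots> = (LINT \<theta>|M. cmod (f \<theta> - g \<theta>)) + (LINT \<theta>|M. cmod (g \<theta> - h \<theta>))"
    using assms by (intro Bochner_Integration.integral_add integrable_norm Bochner_Integration.integrable_diff)
  finally show ?thesis .
qed

text \<open>Dominated limits are limits in \<open>L\<^sup>1\<close>. This closure property carries out all the passages from
  continuous periodic functions to integrable functions below.\<close>
lemma trig_approximable_dominated_limit:
  fixes F :: "nat \<Rightarrow> real \<Rightarrow> complex"
  assumes F: "\<And>n. trig_approximable (F n)"
    and f: "f \<in> borel_measurable circle" and w: "integrable circle w"
    and lim: "AE \<theta> in circle. (\<lambda>n. F n \<theta>) \<longlonglongrightarrow> f \<theta>"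
    and bound: "\<And>n. AE \<theta> in circle. cmod (F n \<theta>) \<le> w \<theta>"
  shows "trig_approximable f"
proof -
  have Fi: "integrable circle (F n)" for n using F by (simp add: trig_approximable_def)
  have Fm: "F n \<in> borel_measurable circle" for n using Fi by simp
  have fi: "integrable circle f"
    by (rule integrable_dominated_convergence[OF f Fm w lim bound])
  have "(\<lambda>n. LINT \<theta>|circle. cmod (f \<theta> - F n \<theta>)) \<longlonglongrightarrow> (LINT \<theta>|circle. 0)"
  proof (rule integral_dominated_convergence[where w = "\<lambda>\<theta>. cmod (f \<theta>) + w \<theta>"])
    show "AE \<theta> in circle. (\<lambda>n. cmod (f \<theta> - F n \<theta>)) \<longlonglongrightarrow> 0"
      using lim
    proof eventually_elim
      case (elim \<theta>)
      have "(\<lambda>n. cmod (f \<theta> - F n \<theta>)) \<longlonglongrightarrow> cmod (f \<theta> - f \<theta>)"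
        by (intro tendsto_intros elim)
      then show ?case by simp
    qed
    show "AE \<theta> in circle. norm (cmod (f \<theta> - F n \<theta>)) \<le> cmod (f \<theta>) + w \<theta>" for n
      using bound[of n] by eventually_elim (simp add: order_trans[OF norm_triangle_ineq4])
  qed (use f Fm fi w in auto)
  then have lim0: "(\<lambda>n. LINT \<theta>|circle. cmod (f \<theta> - F n \<theta>)) \<longlonglongrightarrow> 0" by simp
  show ?thesis unfolding trig_approximable_def
  proof (intro conjI allI impI fi)
    fix \<epsilon> :: real assume \<epsilon>: "\<epsilon> > 0"
    then obtain n where n: "(LINT \<theta>|circle. cmod (f \<theta> - F n \<theta>)) < \<epsilon> / 2"
      using order_tendstoD(2)[OF lim0, of "\<epsilon> / 2"] by (auto simp: eventually_sequentially)
    obtain g where g: "trig_poly g" "(LINT \<theta>|circle. cmod (F n \<theta> - g \<theta>)) < \<epsilon> / 2"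
      using F[of n] \<epsilon> unfolding trig_approximable_def by (meson half_gt_zero)
    show "\<exists>g. trig_poly g \<and> (LINT \<theta>|circle. cmod (f \<theta> - g \<theta>)) < \<epsilon>"
      using L1_triangle[OF fi Fi integrable_trig_poly, of g n] g n by (intro exI[of _ g]) auto
  qed
qed

lemma trig_approximable_circle_function:
  assumes h: "continuous_on (sphere 0 1) h"
  shows "trig_approximable (\<lambda>\<theta>. h (cis \<theta>))"
  unfolding trig_approximable_def
proof (intro conjI allI impI)
  have c: "continuous_on UNIV (\<lambda>\<theta>. h (cis \<theta>))"
    by (rule continuous_on_compose2[OF h]) (auto intro!: continuous_intros)
  then show i: "integrable circle (\<lambda>\<theta>. h (cis \<theta>))" by (rule continuous_integrable_circle)
  fix \<epsilon> :: real assume \<epsilon>: "\<epsilon> > 0"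
  then have "\<epsilon> / (4 * pi) > 0" by simp
  from trig_poly_uniform_approx[OF h this] obtain g where
    g: "trig_poly g" "\<And>\<theta>. cmod (h (cis \<theta>) - g \<theta>) < \<epsilon> / (4 * pi)" by blast
  have "(LINT \<theta>|circle. cmod (h (cis \<theta>) - g \<theta>)) \<le> (LINT \<theta>|circle. \<epsilon> / (4 * pi))"
    using i integrable_trig_poly[OF g(1)] g(2)
    by (intro integral_mono integrable_norm Bochner_Integration.integrable_diff) (auto intro: less_imp_le)
  also have "\<dots> < \<epsilon>" using measure_circle \<epsilon> by simp
  finally show "\<exists>g. trig_poly g \<and> (LINT \<theta>|circle. cmod (h (cis \<theta>) - g \<theta>)) < \<epsilon>" using g(1) by blast
qed

text \<open>A continuous function on the interval need not take the same value at both ends, so it does not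
  descend to the circle. Multiplying by a cut-off \<open>\<kappa> m\<close> that vanishes at \<open>-1\<close> repairs this,
  and the cut-offs tend to 1 everywhere except at the two end points.\<close>
lemma trig_approximable_continuous:
  fixes g :: "real \<Rightarrow> complex"
  assumes g: "continuous_on UNIV g" and M: "\<And>x. cmod (g x) \<le> M"
  shows "trig_approximable g"
proof -
  define \<kappa> where "\<kappa> m z = min 1 (real m * cmod (z + 1))" for m and z :: complex
  define h where "h m z = of_real (\<kappa> m z) * g (Arg z)" for m and z :: complex
  have M0: "M \<ge> 0" using M[of 0] norm_ge_zero order_trans by blast
  have \<kappa>: "0 \<le> \<kappa> m z" "\<kappa> m z \<le> 1" for m z by (auto simp: \<kappa>_def)
  have h_norm: "cmod (h m z) = \<kappa> m z * cmod (g (Arg z))" for m z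
    using \<kappa>[of m z] by (simp add: h_def norm_mult)
  have h_le: "cmod (h m z) \<le> M" for m z
  proof -
    have "\<kappa> m z * cmod (g (Arg z)) \<le> 1 * M"
      by (rule mult_mono) (use \<kappa> M in auto)
    then show ?thesis by (simp add: h_norm)
  qed
  have h_le': "cmod (h m z) \<le> real m * cmod (z + 1) * M" for m z
    unfolding h_norm by (rule mult_mono) (auto simp: M, simp add: \<kappa>_def)
  have hc: "continuous_on (sphere 0 1) (h m)" for m
  proof (rule continuous_at_imp_continuous_on, rule ballI)
    fix z :: complex assume z: "z \<in> sphere 0 1"
    show "isCont (h m) z"
    proof (cases "z \<in> \<real>\<^sub>\<le>\<^sub>0")
      case False
      have "isCont (\<lambda>z. g (Arg z)) z"
        using isCont_o2[OF continuous_at_Arg[OF False], of g] g by (simp add: continuous_on_eq_continuous_at)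
      then show ?thesis unfolding h_def \<kappa>_def by (intro continuous_intros) auto
    next
      case True
      then have z1: "z = -1" using z by (auto simp: complex_nonpos_Reals_iff complex_eq_iff cmod_def)
      have "(h m \<longlongrightarrow> 0) (at z)"
      proof (rule Lim_null_comparison)
        show "\<forall>\<^sub>F y in at z. norm (h m y) \<le> real m * cmod (y + 1) * M"
          by (intro always_eventually allI h_le')
        have "((\<lambda>y. real m * cmod (y + 1) * M) \<longlongrightarrow> real m * cmod (z + 1) * M) (at z)"
          by (intro tendsto_intros)
        then show "((\<lambda>y. real m * cmod (y + 1) * M) \<longlongrightarrow> 0) (at z)" by (simp add: z1)
      qed
      moreover have "h m z = 0" by (simp add: h_def \<kappa>_def z1)
      ultimately show ?thesis by (simp add: isCont_def)
    qed
  qed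
  show ?thesis
  proof (rule trig_approximable_dominated_limit)
    show "trig_approximable (\<lambda>\<theta>. h n (cis \<theta>))" for n
      by (rule trig_approximable_circle_function[OF hc])
    show "g \<in> borel_measurable circle" by (rule continuous_measurable_circle[OF g])
    show "integrable circle (\<lambda>_. M)" by simp
    show "AE \<theta> in circle. cmod (h n (cis \<theta>)) \<le> M" for n
      by (intro AE_I2 h_le)
    have "{pi, -pi} \<in> null_sets circle"
      by (subst null_sets_restrict_space) (auto simp flip: negligible_iff_null_sets)
    then have "AE \<theta> in circle. \<theta> \<notin> {pi, -pi}" by (rule AE_not_in)
    with AE_space show "AE \<theta> in circle. (\<lambda>n. h n (cis \<theta>)) \<longlonglongrightarrow> g \<theta>"
    proof eventually_elim
      case (elim \<theta>)
      then have \<theta>: "- pi < \<theta>" "\<theta> < pi" by auto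
      then have Arg: "Arg (cis \<theta>) = \<theta>" by (intro Arg_cis) auto
      have "cis \<theta> \<noteq> - 1"
      proof
        assume "cis \<theta> = -1"
        then have "Arg (cis \<theta>) = pi" using Arg_cis[of pi] by (simp add: cis_pi)
        then show False using Arg \<theta> by simp
      qed
      then have pos: "cmod (cis \<theta> + 1) > 0" by (simp add: add_eq_0_iff2)
      then obtain N where N: "real N * cmod (cis \<theta> + 1) > 1"
        using reals_Archimedean3 by blast
      have "\<forall>\<^sub>F n in sequentially. h n (cis \<theta>) = g \<theta>"
        using eventually_ge_at_top[of N]
      proof eventually_elim
        case (elim n)
        have "real n * cmod (cis \<theta> + 1) \<ge> real N * cmod (cis \<theta> + 1)"
          using elim pos by (intro mult_right_mono) auto
        then show ?case using N by (simp add: h_def \<kappa>_def Arg)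
      qed
      then show ?case by (rule tendsto_eventually)
    qed
  qed
qed

text \<open>A measurable function is an almost everywhere limit of continuous ones. Projecting these onto the
  disc of radius \<open>M\<close> keeps them continuous, leaves the limit unchanged and provides the dominating
  constant.\<close>
lemma trig_approximable_bounded:
  fixes f :: "real \<Rightarrow> complex"
  assumes f: "f \<in> borel_measurable circle" and M: "\<And>x. cmod (f x) \<le> M"
  shows "trig_approximable f"
proof -
  have M0: "M \<ge> 0" using M[of 0] norm_ge_zero order_trans by blast
  have "f measurable_on {-pi..pi}"
    using f by (simp add: measurable_on_iff_borel_measurable)
  then obtain N g where N: "negligible N" and g: "\<And>n. continuous_on UNIV (g n)"
    and lim: "\<And>x. x \<notin> N \<Longrightarrow> (\<lambda>n. g n x) \<longlonglongrightarrow> (if x \<in> {-pi..pi} then f x else 0)"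
    unfolding measurable_on_def by blast
  let ?clip = "closest_point (cball (0::complex) M)"
  have clip: "continuous_on UNIV ?clip"
    using M0 by (intro continuous_on_closest_point) auto
  have clip_le: "cmod (?clip z) \<le> M" for z
    using closest_point_in_set[of "cball (0::complex) M" z] M0 by auto
  show ?thesis
  proof (rule trig_approximable_dominated_limit)
    show "trig_approximable (\<lambda>x. ?clip (g n x))" for n
      by (rule trig_approximable_continuous[OF continuous_on_compose2[OF clip g] clip_le]) auto
    show "f \<in> borel_measurable circle" by fact
    show "integrable circle (\<lambda>_. M)" by simp
    show "AE \<theta> in circle. cmod (?clip (g n \<theta>)) \<le> M" for n by (simp add: clip_le)
    have "AE \<theta> in lebesgue. \<theta> \<notin> N"
      using N by (intro AE_not_in) (simp add: negligible_iff_null_sets)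
    then have "AE \<theta> in circle. \<theta> \<notin> N"
      by (subst AE_restrict_space_iff) auto
    with AE_space show "AE \<theta> in circle. (\<lambda>n. ?clip (g n \<theta>)) \<longlonglongrightarrow> f \<theta>"
    proof eventually_elim
      case (elim \<theta>)
      then have "(\<lambda>n. g n \<theta>) \<longlonglongrightarrow> f \<theta>" using lim[of \<theta>] by simp
      then have "(\<lambda>n. ?clip (g n \<theta>)) \<longlonglongrightarrow> ?clip (f \<theta>)"
        using clip by (intro isCont_tendsto_compose[of "f \<theta>" ?clip]) (auto simp: continuous_on_eq_continuous_at)
      moreover have "?clip (f \<theta>) = f \<theta>" using M by (intro closest_point_self) auto
      ultimately show ?case by simp
    qed
  qed
qed

lemma trig_poly_dense_L1:
  fixes f :: "real \<Rightarrow> complex"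
  assumes f: "integrable circle f"
  shows "trig_approximable f"
proof -
  have fm[measurable]: "f \<in> borel_measurable circle" using f by simp
  define F where "F n \<theta> = (if cmod (f \<theta>) \<le> real n then f \<theta> else 0)" for n \<theta>
  show ?thesis
  proof (rule trig_approximable_dominated_limit[where F = F])
    show "trig_approximable (F n)" for n
    proof (rule trig_approximable_bounded)
      show "F n \<in> borel_measurable circle" unfolding F_def by measurable
      show "cmod (F n \<theta>) \<le> real n" for \<theta> by (simp add: F_def)
    qed
    show "integrable circle (\<lambda>\<theta>. cmod (f \<theta>))" using f by simp
    show "AE \<theta> in circle. cmod (F n \<theta>) \<le> cmod (f \<theta>)" for n by (simp add: F_def)
    show "AE \<theta> in circle. (\<lambda>n. F n \<theta>) \<longlonglongrightarrow> f \<theta>"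
    proof (intro AE_I2 tendsto_eventually)
      fix \<theta>
      have "\<forall>\<^sub>F n in sequentially. real n \<ge> cmod (f \<theta>)"
        using filterlim_real_sequentially by (rule filterlim_at_top[THEN iffD1, rule_format])
      then show "\<forall>\<^sub>F n in sequentially. F n \<theta> = f \<theta>"
        by eventually_elim (simp add: F_def)
    qed
  qed (rule fm)
qed

section \<open>Fejer means\<close>

text \<open>The Fejer mean as an average over differences of two indices. In this form its kernel is visibly a
  square, and the usual weights \<open>1 - \<bar>m\<bar>/N\<close> are recovered by counting.\<close>
definition fejer_mean :: "nat \<Rightarrow> (real \<Rightarrow> complex) \<Rightarrow> real \<Rightarrow> complex" where
  "fejer_mean N f x = (\<Sum>j<N. \<Sum>k<N. fourier_coeff f (int j - int k) * exp (\<i> * of_int (int j - int k) * of_real x)) / of_nat N"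

lemma integrable_times_exp:
  fixes f :: "real \<Rightarrow> complex"
  assumes "integrable circle f"
  shows "integrable circle (\<lambda>\<theta>. f \<theta> * exp (- \<i> * of_int k * of_real \<theta>))"
proof (rule Bochner_Integration.integrable_bound[OF assms])
  have "(\<lambda>\<theta>. exp (- \<i> * of_int k * of_real \<theta>)) \<in> borel_measurable circle"
    by (intro continuous_measurable_circle continuous_intros)
  then show "(\<lambda>\<theta>. f \<theta> * exp (- \<i> * of_int k * of_real \<theta>)) \<in> borel_measurable circle"
    using assms by measurable
qed (simp add: norm_mult)

lemma fourier_coeff_diff:
  assumes "integrable circle f" "integrable circle g"
  shows "fourier_coeff (\<lambda>\<theta>. f \<theta> - g \<theta>) k = fourier_coeff f k - fourier_coeff g k"
  unfolding fourier_coeff_circle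
  using integrable_times_exp[OF assms(1), of k] integrable_times_exp[OF assms(2), of k]
  by (simp add: left_diff_distrib right_diff_distrib diff_divide_distrib)

lemma fourier_coeff_add:
  assumes "integrable circle f" "integrable circle g"
  shows "fourier_coeff (\<lambda>\<theta>. f \<theta> + g \<theta>) k = fourier_coeff f k + fourier_coeff g k"
  unfolding fourier_coeff_circle
  using integrable_times_exp[OF assms(1), of k] integrable_times_exp[OF assms(2), of k]
  by (simp add: distrib_left distrib_right add_divide_distrib)

lemma fourier_coeff_monomial:
  "fourier_coeff (\<lambda>\<theta>. c * exp (\<i> * of_int m * of_real \<theta>)) k = c * of_bool (k = m)"
proof -
  have "exp (\<i> * of_int m * of_real \<theta>) * exp (- \<i> * of_int k * of_real \<theta>)
      = exp (- \<i> * of_int (k - m) * of_real \<theta>)" for \<theta> :: real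
    by (simp add: exp_add[symmetric] algebra_simps)
  then have "fourier_coeff (\<lambda>\<theta>. c * exp (\<i> * of_int m * of_real \<theta>)) k = c * fourier_coeff (\<lambda>_. 1) (k - m)"
    by (simp add: fourier_coeff_circle mult.assoc)
  then show ?thesis by (simp add: fourier_coeff_const_1)
qed

lemma fejer_mean_diff:
  assumes "integrable circle f" "integrable circle g"
  shows "fejer_mean N (\<lambda>\<theta>. f \<theta> - g \<theta>) x = fejer_mean N f x - fejer_mean N g x"
  by (simp add: fejer_mean_def fourier_coeff_diff[OF assms] sum_subtractf left_diff_distrib diff_divide_distrib)

lemma fejer_mean_add:
  assumes "integrable circle f" "integrable circle g"
  shows "fejer_mean N (\<lambda>\<theta>. f \<theta> + g \<theta>) x = fejer_mean N f x + fejer_mean N g x"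
  by (simp add: fejer_mean_def fourier_coeff_add[OF assms] sum.distrib distrib_right add_divide_distrib)

lemma integrable_fejer_mean: "integrable circle (fejer_mean N f)"
  unfolding fejer_mean_def divide_inverse by (intro continuous_integrable_circle continuous_intros)

lemma fejer_mean_kernel:
  assumes f: "integrable circle f"
  shows "fejer_mean N f x = (LINT \<theta>|circle. f \<theta> * of_real ((cmod (\<Sum>j<N. exp (\<i> * of_nat j * of_real (x - \<theta>))))\<^sup>2))
    / (2 * of_real pi * of_nat N)"
proof -
  have pw: "f \<theta> * of_real ((cmod (\<Sum>j<N. exp (\<i> * of_nat j * of_real (x - \<theta>))))\<^sup>2)
     = (\<Sum>j<N. \<Sum>k<N. exp (\<i> * of_int (int j - int k) * of_real x) * (f \<theta> * exp (- \<i> * of_int (int j - int k) * of_real \<theta>)))" for \<theta>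
  proof -
    have "complex_of_real ((cmod (\<Sum>j<N. exp (\<i> * of_nat j * of_real (x - \<theta>))))\<^sup>2)
      = (\<Sum>j<N. \<Sum>k<N. exp (\<i> * of_nat j * of_real (x - \<theta>)) * exp (- (\<i> * of_nat k * of_real (x - \<theta>))))"
      unfolding complex_norm_square cnj_sum sum_product by (simp add: exp_cnj)
    also have "\<dots> = (\<Sum>j<N. \<Sum>k<N. exp (\<i> * of_int (int j - int k) * of_real x) * exp (- \<i> * of_int (int j - int k) * of_real \<theta>))"
      unfolding exp_add[symmetric] by (intro sum.cong refl arg_cong[where f = exp]) (simp add: algebra_simps)
    finally show ?thesis by (simp add: sum_distrib_left mult_ac)
  qed
  show ?thesis
    unfolding pw fejer_mean_def fourier_coeff_circle
    by (simp only: Bochner_Integration.integral_sum Bochner_Integration.integrable_sum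
        integrable_mult_right integrable_times_exp[OF f] integral_mult_right_zero)
       (simp add: sum_divide_distrib mult_ac)
qed

text \<open>Positivity of the kernel.\<close>
lemma fejer_mean_norm_le:
  assumes f: "integrable circle f"
  shows "cmod (fejer_mean N f x) \<le> Re (fejer_mean N (\<lambda>\<theta>. of_real (cmod (f \<theta>))) x)"
proof -
  let ?K = "\<lambda>\<theta>. (cmod (\<Sum>j<N. exp (\<i> * of_nat j * of_real (x - \<theta>))))\<^sup>2"
  have "cmod (fejer_mean N f x) = cmod (LINT \<theta>|circle. f \<theta> * of_real (?K \<theta>)) / (2 * pi * N)"
    by (simp add: fejer_mean_kernel[OF f] norm_divide norm_mult)
  also have "\<dots> \<le> (LINT \<theta>|circle. cmod (f \<theta> * of_real (?K \<theta>))) / (2 * pi * N)"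
    by (intro divide_right_mono integral_norm_bound) auto
  also have "(LINT \<theta>|circle. cmod (f \<theta> * of_real (?K \<theta>))) = (LINT \<theta>|circle. cmod (f \<theta>) * ?K \<theta>)"
    by (simp add: norm_mult norm_power)
  also have "\<dots> / (2 * pi * N) = Re (of_real (LINT \<theta>|circle. cmod (f \<theta>) * ?K \<theta>) / (2 * of_real pi * of_nat N))"
  proof -
    have "2 * complex_of_real pi * of_nat N = of_real (2 * pi * N)" by simp
    then show ?thesis by (simp only: of_real_divide[symmetric] Re_complex_of_real)
  qed
  also have "\<dots> = Re (fejer_mean N (\<lambda>\<theta>. of_real (cmod (f \<theta>))) x)"
    using f by (subst fejer_mean_kernel) (simp_all only: of_real_mult[symmetric] integral_complex_of_real integrable_of_real integrable_norm)
  finally show ?thesis .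
qed

text \<open>Only the terms with equal indices have a nonzero integral.\<close>
lemma integral_fejer_mean:
  assumes N: "N > 0"
  shows "(LINT x|circle. fejer_mean N f x) = (LINT \<theta>|circle. f \<theta>)"
proof -
  have e: "(LINT x|circle. exp (\<i> * of_int m * of_real x)) = 2 * of_real pi * of_bool (m = 0)" for m
    using fourier_coeff_const_1[of "- m"] by (simp add: fourier_coeff_circle field_simps split: if_splits)
  have i: "integrable circle (\<lambda>x. exp (\<i> * of_int m * of_real x))" for m
    by (intro continuous_integrable_circle continuous_intros)
  have "(LINT x|circle. fejer_mean N f x)
     = (\<Sum>j<N. \<Sum>k<N. fourier_coeff f (int j - int k) * (LINT x|circle. exp (\<i> * of_int (int j - int k) * of_real x))) / of_nat N"
    unfolding fejer_mean_def
    by (simp only: integral_divide_zero Bochner_Integration.integral_sum Bochner_Integration.integrable_sum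
        integrable_mult_right i integral_mult_right_zero)
  also have "\<dots> = (\<Sum>j<N. \<Sum>k<N. if j = k then fourier_coeff f 0 * (2 * of_real pi) else 0) / of_nat N"
    unfolding e by (intro arg_cong2[where f = "(/)"] sum.cong refl) auto
  also have "\<dots> = (LINT \<theta>|circle. f \<theta>)"
    using N by (simp add: fourier_coeff_circle)
  finally show ?thesis .
qed

text \<open>The mean of \<open>f\<close> is dominated by the mean of \<open>\<bar>f\<bar>\<close>, and the latter has the same integral as \<open>\<bar>f\<bar>\<close>.\<close>
lemma fejer_mean_L1_contraction:
  assumes f: "integrable circle f" and N: "N > 0"
  shows "(LINT x|circle. cmod (fejer_mean N f x)) \<le> (LINT x|circle. cmod (f x))"
proof -
  have "(LINT x|circle. cmod (fejer_mean N f x)) \<le> (LINT x|circle. Re (fejer_mean N (\<lambda>\<theta>. of_real (cmod (f \<theta>))) x))"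
    by (intro integral_mono fejer_mean_norm_le f integrable_norm integrable_Re integrable_fejer_mean)
  also have "\<dots> = Re (LINT x|circle. fejer_mean N (\<lambda>\<theta>. of_real (cmod (f \<theta>))) x)"
    by (rule integral_Re[OF integrable_fejer_mean])
  also have "\<dots> = (LINT x|circle. cmod (f x))"
    by (simp add: integral_fejer_mean[OF N])
  finally show ?thesis .
qed

definition diff_count :: "nat \<Rightarrow> int \<Rightarrow> nat" where
  "diff_count N m = card {p \<in> {..<N} \<times> {..<N}. int (fst p) - int (snd p) = m}"

lemma sum_differences:
  fixes F :: "int \<Rightarrow> complex"
  shows "(\<Sum>j<N. \<Sum>k<N. F (int j - int k)) = (\<Sum>m\<in>{- int N..int N}. of_nat (diff_count N m) * F m)"
proof -
  have "(\<Sum>j<N. \<Sum>k<N. F (int j - int k)) = (\<Sum>p\<in>{..<N} \<times> {..<N}. F (int (fst p) - int (snd p)))"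
    by (simp add: sum.cartesian_product case_prod_beta)
  also have "\<dots> = (\<Sum>m\<in>{- int N..int N}. \<Sum>p\<in>{p \<in> {..<N} \<times> {..<N}. int (fst p) - int (snd p) = m}. F (int (fst p) - int (snd p)))"
    by (rule sum.group[symmetric]) auto
  also have "\<dots> = (\<Sum>m\<in>{- int N..int N}. of_nat (diff_count N m) * F m)"
    by (intro sum.cong refl) (simp add: diff_count_def)
  finally show ?thesis .
qed

lemma diff_count_le: "diff_count N m \<le> N"
proof -
  have "diff_count N m = card (snd ` {p \<in> {..<N} \<times> {..<N}. int (fst p) - int (snd p) = m})"
    unfolding diff_count_def by (rule card_image[symmetric]) (auto simp: inj_on_def)
  also have "\<dots> \<le> card {..<N}" by (intro card_mono) auto
  finally show ?thesis by simp
qed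

lemma diff_count_ge: "N - nat \<bar>m\<bar> \<le> diff_count N m"
proof -
  have "N - nat \<bar>m\<bar> = card ((\<lambda>k. (k + nat m, k + nat (- m))) ` {..<N - nat \<bar>m\<bar>})"
    by (subst card_image) (auto simp: inj_on_def)
  also have "\<dots> \<le> diff_count N m"
    unfolding diff_count_def by (intro card_mono) auto
  finally show ?thesis .
qed

lemma diff_count_ratio: "(\<lambda>N. real (diff_count N m) / real N) \<longlonglongrightarrow> 1"
proof (rule tendsto_sandwich)
  have "1 - real (nat \<bar>m\<bar>) / real N \<le> real (diff_count N m) / real N" if "N \<ge> 1" for N
  proof -
    have "(real N - real (nat \<bar>m\<bar>)) / real N \<le> real (diff_count N m) / real N"
      using diff_count_ge[of N m] by (intro divide_right_mono) linarith+
    then show ?thesis using that by (simp add: diff_divide_distrib)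
  qed
  then show "\<forall>\<^sub>F N in sequentially. 1 - real (nat \<bar>m\<bar>) / real N \<le> real (diff_count N m) / real N"
    by (rule eventually_sequentiallyI)
  show "\<forall>\<^sub>F N in sequentially. real (diff_count N m) / real N \<le> 1"
    using diff_count_le by (intro always_eventually) (auto simp: divide_le_eq)
  have "(\<lambda>N. 1 - real (nat \<bar>m\<bar>) / real N) \<longlonglongrightarrow> 1 - 0"
    by (intro tendsto_diff tendsto_const lim_const_over_n)
  then show "(\<lambda>N. 1 - real (nat \<bar>m\<bar>) / real N) \<longlonglongrightarrow> 1" by simp
qed simp

text \<open>The mean of \<open>exp(i m \<theta>)\<close> is this function times the proportion \<open>diff_count N m / N\<close>.\<close>
lemma fejer_mean_trig_poly_tendsto:
  assumes "trig_poly g"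
  shows "(\<lambda>N. LINT x|circle. cmod (g x - fejer_mean N g x)) \<longlonglongrightarrow> 0"
  using assms
proof (induction rule: trig_poly.induct)
  case (monomial c m)
  let ?e = "\<lambda>x. c * exp (\<i> * of_int m * of_real x)"
  have fm: "fejer_mean N ?e x = of_real (real (diff_count N m) / real N) * ?e x" if "N > nat \<bar>m\<bar>" for N x
  proof -
    have "(\<Sum>j<N. \<Sum>k<N. fourier_coeff ?e (int j - int k) * exp (\<i> * of_int (int j - int k) * of_real x))
       = (\<Sum>l\<in>{- int N..int N}. of_nat (diff_count N l) * (fourier_coeff ?e l * exp (\<i> * of_int l * of_real x)))"
      by (rule sum_differences)
    also have "\<dots> = (\<Sum>l\<in>{- int N..int N}. if l = m then of_nat (diff_count N m) * ?e x else 0)"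
      by (intro sum.cong refl) (simp add: fourier_coeff_monomial)
    also have "\<dots> = of_nat (diff_count N m) * ?e x"
    proof -
      have "m \<in> {- int N..int N}" using that by auto
      then show ?thesis by simp
    qed
    finally show ?thesis by (simp add: fejer_mean_def)
  qed
  have "(LINT x|circle. cmod (?e x - fejer_mean N ?e x)) = cmod (of_real (1 - real (diff_count N m) / real N)) * (cmod c * (2 * pi))"
    if N: "N > nat \<bar>m\<bar>" for N
  proof -
    have "?e x - fejer_mean N ?e x = of_real (1 - real (diff_count N m) / real N) * ?e x" for x
      using fm[OF N, of x] by (simp add: algebra_simps)
    then show ?thesis using measure_circle by (simp add: norm_mult del: of_real_diff)
  qed
  then have "\<forall>\<^sub>F N in sequentially. \<bar>1 - real (diff_count N m) / real N\<bar> * (cmod c * (2 * pi)) = (LINT x|circle. cmod (?e x - fejer_mean N ?e x))"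
    by (intro eventually_sequentiallyI[of "Suc (nat \<bar>m\<bar>)"]) (simp del: of_real_diff)
  moreover have "(\<lambda>N. \<bar>1 - real (diff_count N m) / real N\<bar> * (cmod c * (2 * pi))) \<longlonglongrightarrow> \<bar>1 - 1\<bar> * (cmod c * (2 * pi))"
    by (intro tendsto_intros diff_count_ratio)
  ultimately show ?case by (simp add: tendsto_cong)
next
  case (add f g)
  have fi: "integrable circle f" "integrable circle g" using add.hyps by (auto intro: integrable_trig_poly)
  show ?case
  proof (rule tendsto_sandwich[OF _ _ tendsto_const])
    show "\<forall>\<^sub>F N in sequentially. 0 \<le> (LINT x|circle. cmod (f x + g x - fejer_mean N (\<lambda>\<theta>. f \<theta> + g \<theta>) x))"
      by simp
    show "\<forall>\<^sub>F N in sequentially. (LINT x|circle. cmod (f x + g x - fejer_mean N (\<lambda>\<theta>. f \<theta> + g \<theta>) x))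
       \<le> (LINT x|circle. cmod (f x - fejer_mean N f x)) + (LINT x|circle. cmod (g x - fejer_mean N g x))"
    proof (intro always_eventually allI)
      fix N
      have i: "integrable circle (\<lambda>x. cmod (f x - fejer_mean N f x))" "integrable circle (\<lambda>x. cmod (g x - fejer_mean N g x))"
        using fi by (auto intro!: integrable_norm Bochner_Integration.integrable_diff integrable_fejer_mean)
      have "cmod (f x + g x - fejer_mean N (\<lambda>\<theta>. f \<theta> + g \<theta>) x) \<le> cmod (f x - fejer_mean N f x) + cmod (g x - fejer_mean N g x)" for x
        unfolding fejer_mean_add[OF fi] by (rule norm_diff_triangle_ineq)
      then show "(LINT x|circle. cmod (f x + g x - fejer_mean N (\<lambda>\<theta>. f \<theta> + g \<theta>) x))
       \<le> (LINT x|circle. cmod (f x - fejer_mean N f x)) + (LINT x|circle. cmod (g x - fejer_mean N g x))"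
        unfolding Bochner_Integration.integral_add[OF i, symmetric]
        using fi i by (intro integral_mono integrable_norm Bochner_Integration.integrable_diff
            Bochner_Integration.integrable_add integrable_fejer_mean)
    qed
    show "(\<lambda>N. (LINT x|circle. cmod (f x - fejer_mean N f x)) + (LINT x|circle. cmod (g x - fejer_mean N g x))) \<longlonglongrightarrow> 0"
      using tendsto_add[OF add.IH] by simp
  qed
qed

text \<open>Convergence on a dense set together with the uniform contraction property.\<close>
theorem fejer_mean_L1_approx:
  assumes f: "integrable circle f" and \<epsilon>: "\<epsilon> > 0"
  obtains N where "N > 0" "(LINT x|circle. cmod (f x - fejer_mean N f x)) < \<epsilon>"
proof -
  obtain g where g: "trig_poly g" "(LINT \<theta>|circle. cmod (f \<theta> - g \<theta>)) < \<epsilon> / 3"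
    using trig_poly_dense_L1[OF f] \<epsilon> unfolding trig_approximable_def by (meson divide_pos_pos zero_less_numeral)
  have gi: "integrable circle g" by (rule integrable_trig_poly[OF g(1)])
  have "\<forall>\<^sub>F N in sequentially. (LINT x|circle. cmod (g x - fejer_mean N g x)) < \<epsilon> / 3"
    using order_tendstoD(2)[OF fejer_mean_trig_poly_tendsto[OF g(1)], of "\<epsilon> / 3"] \<epsilon> by simp
  then obtain N where N: "N > 0" "(LINT x|circle. cmod (g x - fejer_mean N g x)) < \<epsilon> / 3"
    using eventually_happens'[OF _ eventually_conj[OF eventually_gt_at_top[of 0]]] by (metis (no_types, lifting) trivial_limit_sequentially)
  have "(LINT x|circle. cmod (fejer_mean N g x - fejer_mean N f x)) = (LINT x|circle. cmod (fejer_mean N (\<lambda>\<theta>. g \<theta> - f \<theta>) x))"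
    by (simp add: fejer_mean_diff[OF gi f])
  also have "\<dots> \<le> (LINT x|circle. cmod (g x - f x))"
    by (rule fejer_mean_L1_contraction[OF _ N(1)]) (use gi f in simp)
  also have "\<dots> < \<epsilon> / 3" using g(2) by (simp add: norm_minus_commute)
  finally have "(LINT x|circle. cmod (fejer_mean N g x - fejer_mean N f x)) < \<epsilon> / 3" .
  then have "(LINT x|circle. cmod (f x - fejer_mean N f x)) < \<epsilon>"
    using g(2) N(2) L1_triangle[OF f gi integrable_fejer_mean[of N f]]
      L1_triangle[OF gi integrable_fejer_mean[of N g] integrable_fejer_mean[of N f]] by linarith
  then show thesis using that N(1) by blast
qed

text \<open>Every coefficient of the Fejer mean is a real multiple of the corresponding coefficient of \<open>f\<close>, so
  real coefficients stay real.\<close>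
lemma fejer_mean_eq_symbol:
  defines "a \<equiv> (\<lambda>N f m. of_nat (diff_count N m) * fourier_coeff f m / of_nat N)"
  shows "band (a N f) N" "fejer_mean N f = band.symbol (a N f) N"
proof -
  show b: "band (a N f) N"
  proof
    fix k assume "\<bar>k\<bar> > int N"
    then have "{p \<in> {..<N} \<times> {..<N}. int (fst p) - int (snd p) = k} = {}" by auto
    then show "a N f k = 0" by (simp add: a_def diff_count_def)
  qed
  show "fejer_mean N f = band.symbol (a N f) N"
  proof (rule ext)
    fix x
    have "(\<Sum>j<N. \<Sum>k<N. fourier_coeff f (int j - int k) * exp (\<i> * of_int (int j - int k) * of_real x))
       = (\<Sum>m\<in>{- int N..int N}. of_nat (diff_count N m) * (fourier_coeff f m * exp (\<i> * of_int m * of_real x)))"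
      by (rule sum_differences)
    then have "fejer_mean N f x = (\<Sum>m\<in>{- int N..int N}. a N f m * exp (\<i> * of_int m * of_real x))"
      by (simp add: fejer_mean_def a_def sum_divide_distrib mult_ac)
    then show "fejer_mean N f x = band.symbol (a N f) N x"
      by (simp only: band.symbol_def[OF b])
  qed
qed

section \<open>Empirical laws and symmetrized laws\<close>

definition empirical_law :: "nat \<Rightarrow> (nat \<Rightarrow> real) \<Rightarrow> real measure" where
  "empirical_law n d = distr (measure_pmf (pmf_of_set {..<n})) borel d"

lemma real_distribution_empirical_law: "real_distribution (empirical_law n d)"
  unfolding empirical_law_def
  by (rule prob_space.real_distribution_distr) (auto simp: measure_pmf.prob_space_axioms)

lemma integral_empirical_law:
  fixes \<phi> :: "real \<Rightarrow> 'b :: {banach, second_countable_topology}"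
  assumes "n > 0" "\<phi> \<in> borel_measurable borel"
  shows "integrable (empirical_law n d) \<phi>"
    and "(LINT x|empirical_law n d. \<phi> x) = (1 / real n) *\<^sub>R (\<Sum>j<n. \<phi> (d j))"
proof -
  have ne: "{..<n} \<noteq> {}" using assms(1) by auto
  have "set_pmf (pmf_of_set {..<n}) = {..<n}" using ne by (intro set_pmf_of_set) auto
  then have "integrable (measure_pmf (pmf_of_set {..<n})) (\<lambda>j. \<phi> (d j))"
    by (intro integrable_measure_pmf_finite) simp
  then show "integrable (empirical_law n d) \<phi>"
    unfolding empirical_law_def using assms(2) by (subst integrable_distr_eq) simp_all
  have "(LINT x|empirical_law n d. \<phi> x) = (LINT j|measure_pmf (pmf_of_set {..<n}). \<phi> (d j))"
    unfolding empirical_law_def using assms by (subst integral_distr) auto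
  also have "\<dots> = (\<Sum>j<n. pmf (pmf_of_set {..<n}) j *\<^sub>R \<phi> (d j))"
    using ne by (intro integral_measure_pmf) auto
  also have "\<dots> = (1 / real n) *\<^sub>R (\<Sum>j<n. \<phi> (d j))"
    using ne by (simp add: pmf_of_set scaleR_sum_right)
  finally show "(LINT x|empirical_law n d. \<phi> x) = (1 / real n) *\<^sub>R (\<Sum>j<n. \<phi> (d j))" .
qed

lemma measure_empirical_law:
  assumes "n > 0" "A \<in> sets borel"
  shows "measure (empirical_law n d) A = real (card {j. j < n \<and> d j \<in> A}) / real n"
proof -
  interpret real_distribution "empirical_law n d" by (rule real_distribution_empirical_law)
  have "measure (empirical_law n d) A = (LINT x|empirical_law n d. indicator A x)" by simp
  also have "\<dots> = (1 / real n) *\<^sub>R (\<Sum>j<n. indicator A (d j))"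
    using assms by (intro integral_empirical_law) auto
  also have "(\<Sum>j<n. indicator A (d j)) = real (card {j. j < n \<and> d j \<in> A})"
    by (simp add: indicator_def sum.If_cases Int_def lessThan_def conj_commute)
  finally show ?thesis by simp
qed

definition uniform_circle :: "real measure" where
  "uniform_circle = density circle (\<lambda>_. ennreal (1 / (2 * pi)))"

lemma prob_space_uniform_circle: "prob_space uniform_circle"
proof (rule prob_spaceI)
  have "emeasure uniform_circle (space uniform_circle) = ennreal (1 / (2 * pi)) * emeasure circle (space circle)"
    by (simp add: uniform_circle_def emeasure_density_const)
  also have "\<dots> = ennreal (1 / (2 * pi) * (2 * pi))"
    using measure_circle by (subst ennreal_mult) (auto simp: circle.emeasure_eq_measure)
  finally show "emeasure uniform_circle (space uniform_circle) = 1" by simp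
qed

lemma measurable_uniform_circle [simp]: "borel_measurable uniform_circle = borel_measurable circle"
  unfolding uniform_circle_def by (rule measurable_cong_sets) simp_all

text \<open>The law of \<open>\<plusminus>\<bar>g(\<theta>)\<bar>\<close> with \<open>\<theta>\<close> uniform on \<open>[-\<pi>,\<pi>]\<close> and an independent fair sign.\<close>
definition symmetrized_law :: "(real \<Rightarrow> complex) \<Rightarrow> real measure" where
  "symmetrized_law g = distr (uniform_circle \<Otimes>\<^sub>M measure_pmf (pmf_of_set (UNIV :: bool set))) borel
     (\<lambda>(\<theta>, s). if s then cmod (g \<theta>) else - cmod (g \<theta>))"

lemma
  assumes g: "g \<in> borel_measurable circle"
  shows real_distribution_symmetrized_law: "real_distribution (symmetrized_law g)"
    and integral_symmetrized_law: "\<And>\<phi> :: real \<Rightarrow> 'b :: {banach, second_countable_topology}.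
      \<phi> \<in> borel_measurable borel \<Longrightarrow>
      (\<And>\<theta>. \<theta> \<in> {-pi..pi} \<Longrightarrow> norm (\<phi> (cmod (g \<theta>))) \<le> B) \<Longrightarrow>
      (\<And>\<theta>. \<theta> \<in> {-pi..pi} \<Longrightarrow> norm (\<phi> (- cmod (g \<theta>))) \<le> B) \<Longrightarrow>
      integrable (symmetrized_law g) \<phi> \<and>
      (LINT x|symmetrized_law g. \<phi> x) = (1 / (2 * pi)) *\<^sub>R (LINT \<theta>|circle. (1 / 2) *\<^sub>R (\<phi> (cmod (g \<theta>)) + \<phi> (- cmod (g \<theta>))))"
proof -
  define S where "S = measure_pmf (pmf_of_set (UNIV :: bool set))"
  define X where "X = (\<lambda>(\<theta>, s). if s then cmod (g \<theta>) else - cmod (g \<theta>))"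
  interpret U: prob_space uniform_circle by (rule prob_space_uniform_circle)
  interpret S: prob_space S unfolding S_def by (rule measure_pmf.prob_space_axioms)
  interpret US: pair_prob_space uniform_circle S ..
  have gU[measurable]: "g \<in> borel_measurable uniform_circle" using g by simp
  have sS: "sets S = sets (count_space UNIV)" by (simp add: S_def)
  have [measurable]: "Measurable.pred S (\<lambda>s. s)"
    by (simp add: S_def)
  have X[measurable]: "X \<in> borel_measurable (uniform_circle \<Otimes>\<^sub>M S)"
    unfolding X_def by measurable
  have law: "symmetrized_law g = distr (uniform_circle \<Otimes>\<^sub>M S) borel X"
    by (simp add: symmetrized_law_def S_def X_def)
  show "real_distribution (symmetrized_law g)"
    unfolding law by (rule US.real_distribution_distr[OF X])
  fix \<phi> :: "real \<Rightarrow> 'b"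
  assume \<phi>[measurable]: "\<phi> \<in> borel_measurable borel"
    and B: "\<And>\<theta>. \<theta> \<in> {-pi..pi} \<Longrightarrow> norm (\<phi> (cmod (g \<theta>))) \<le> B"
      "\<And>\<theta>. \<theta> \<in> {-pi..pi} \<Longrightarrow> norm (\<phi> (- cmod (g \<theta>))) \<le> B"
  have sp: "space (uniform_circle \<Otimes>\<^sub>M S) = {-pi..pi} \<times> UNIV"
    by (simp add: space_pair_measure uniform_circle_def S_def)
  have i: "integrable (uniform_circle \<Otimes>\<^sub>M S) (\<lambda>p. \<phi> (X p))"
    by (rule US.integrable_const_bound[of _ B]) (auto intro!: AE_I2 simp: sp X_def B)
  then have "integrable (symmetrized_law g) \<phi>"
    unfolding law by (subst integrable_distr_eq) auto
  moreover have "(LINT x|symmetrized_law g. \<phi> x) = (LINT p|(uniform_circle \<Otimes>\<^sub>M S). \<phi> (X p))"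
    unfolding law by (subst integral_distr) auto
  moreover have "\<dots> = (LINT \<theta>|uniform_circle. LINT s|S. \<phi> (X (\<theta>, s)))"
    using US.integral_fst'[OF i] by simp
  moreover have "(LINT s|S. \<phi> (X (\<theta>, s))) = (1 / 2) *\<^sub>R (\<phi> (cmod (g \<theta>)) + \<phi> (- cmod (g \<theta>)))" for \<theta>
    unfolding S_def by (subst integral_measure_pmf[of UNIV]) (auto simp: UNIV_bool X_def scaleR_add_right)
  moreover have "(LINT \<theta>|uniform_circle. (1 / 2) *\<^sub>R (\<phi> (cmod (g \<theta>)) + \<phi> (- cmod (g \<theta>))))
     = (1 / (2 * pi)) *\<^sub>R (LINT \<theta>|circle. (1 / 2) *\<^sub>R (\<phi> (cmod (g \<theta>)) + \<phi> (- cmod (g \<theta>))))"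
    unfolding uniform_circle_def using g by (subst integral_density) auto
  ultimately show "integrable (symmetrized_law g) \<phi> \<and>
      (LINT x|symmetrized_law g. \<phi> x) = (1 / (2 * pi)) *\<^sub>R (LINT \<theta>|circle. (1 / 2) *\<^sub>R (\<phi> (cmod (g \<theta>)) + \<phi> (- cmod (g \<theta>))))"
    by simp
qed

lemma power_over_fact_tendsto_0: "(\<lambda>n. x ^ n / fact n) \<longlonglongrightarrow> (0 :: real)"
  using summable_LIMSEQ_zero[OF summable_exp[of x]] by (simp add: field_simps)

text \<open>If the even moments grow at most geometrically, uniformly in \<open>n\<close>, then the Taylor remainder of the
  characteristic functions is at most \<open>2 (\<bar>t\<bar> C)\<^sup>N / N!\<close> for even \<open>N\<close>. Truncating at a suitable \<open>N\<close>
  leaves finitely many moments, and those converge.\<close>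
lemma char_tendsto_of_moments:
  fixes \<mu> :: "nat \<Rightarrow> real measure"
  assumes "\<And>n. real_distribution (\<mu> n)" "real_distribution \<nu>"
    and i\<mu>: "\<And>n k. integrable (\<mu> n) (\<lambda>x. x ^ k)" and i\<nu>: "\<And>k. integrable \<nu> (\<lambda>x. x ^ k)"
    and lim: "\<And>k. (\<lambda>n. LINT x|\<mu> n. x ^ k) \<longlonglongrightarrow> (LINT x|\<nu>. x ^ k)"
    and C\<mu>: "\<And>n k. (LINT x|\<mu> n. x ^ (2 * k)) \<le> C ^ (2 * k)"
    and C\<nu>: "\<And>k. (LINT x|\<nu>. x ^ (2 * k)) \<le> C ^ (2 * k)"
  shows "(\<lambda>n. char (\<mu> n) t) \<longlonglongrightarrow> char \<nu> t"
proof (rule LIMSEQ_I)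
  fix \<epsilon> :: real assume \<epsilon>: "\<epsilon> > 0"
  interpret \<mu>: real_distribution "\<mu> n" for n by fact
  interpret \<nu>: real_distribution \<nu> by fact
  have "\<forall>\<^sub>F n in sequentially. (\<bar>t\<bar> * C) ^ n / fact n < \<epsilon> / 6"
    using \<epsilon> by (intro order_tendstoD(2)[OF power_over_fact_tendsto_0]) auto
  then obtain N0 where N0: "\<And>n. n \<ge> N0 \<Longrightarrow> (\<bar>t\<bar> * C) ^ n / fact n < \<epsilon> / 6"
    by (auto simp: eventually_sequentially)
  \<comment> \<open>An even order, so that the absolute moment in the remainder is a plain moment.\<close>
  define N where "N = 2 * N0"
  define T where "T \<rho> = (\<Sum>k\<le>N. ((\<i> * t)^k / fact k) * complex_of_real (LINT x|\<rho>. x^k))" for \<rho>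
  have small: "2 * \<bar>t\<bar> ^ N / fact N * (C ^ N) < \<epsilon> / 3"
  proof -
    have "2 * \<bar>t\<bar> ^ N / fact N * (C ^ N) = 2 * ((\<bar>t\<bar> * C) ^ N / fact N)"
      by (simp add: power_mult_distrib)
    moreover have "(\<bar>t\<bar> * C) ^ N / fact N < \<epsilon> / 6" by (rule N0) (simp add: N_def)
    ultimately show ?thesis by linarith
  qed
  have absN: "\<bar>x :: real\<bar> ^ N = x ^ N" for x by (simp add: N_def power_even_abs)
  have a\<mu>: "cmod (char (\<mu> n) t - T (\<mu> n)) < \<epsilon> / 3" for n
  proof -
    have "cmod (char (\<mu> n) t - T (\<mu> n)) \<le> (2*\<bar>t\<bar>^N / fact N) * (LINT x|\<mu> n. \<bar>x\<bar>^N)"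
      unfolding T_def by (rule \<mu>.char_approx1[OF i\<mu>])
    also have "\<dots> \<le> (2*\<bar>t\<bar>^N / fact N) * C ^ N"
      unfolding absN unfolding N_def by (intro mult_left_mono C\<mu>) auto
    finally show ?thesis using small by simp
  qed
  have a\<nu>: "cmod (char \<nu> t - T \<nu>) < \<epsilon> / 3"
  proof -
    have "cmod (char \<nu> t - T \<nu>) \<le> (2*\<bar>t\<bar>^N / fact N) * (LINT x|\<nu>. \<bar>x\<bar>^N)"
      unfolding T_def by (rule \<nu>.char_approx1[OF i\<nu>])
    also have "\<dots> \<le> (2*\<bar>t\<bar>^N / fact N) * C ^ N"
      unfolding absN unfolding N_def by (intro mult_left_mono C\<nu>) auto
    finally show ?thesis using small by simp
  qed
  have "(\<lambda>n. T (\<mu> n)) \<longlonglongrightarrow> T \<nu>"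
    unfolding T_def by (intro tendsto_intros lim)
  from LIMSEQ_D[OF this, of "\<epsilon> / 3"] \<epsilon> obtain n0 where n0: "\<And>n. n \<ge> n0 \<Longrightarrow> cmod (T (\<mu> n) - T \<nu>) < \<epsilon> / 3"
    by auto
  show "\<exists>n0. \<forall>n\<ge>n0. norm (char (\<mu> n) t - char \<nu> t) < \<epsilon>"
  proof (intro exI allI impI)
    fix n assume "n \<ge> n0"
    have "char (\<mu> n) t - char \<nu> t = (char (\<mu> n) t - T (\<mu> n)) + (T (\<mu> n) - T \<nu>) - (char \<nu> t - T \<nu>)" by simp
    also have "cmod \<dots> \<le> cmod (char (\<mu> n) t - T (\<mu> n)) + cmod (T (\<mu> n) - T \<nu>) + cmod (char \<nu> t - T \<nu>)"
      by (meson add_right_mono norm_triangle_ineq norm_triangle_ineq4 order_trans)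
    also have "\<dots> < \<epsilon>" using a\<mu>[of n] a\<nu> n0[OF \<open>n \<ge> n0\<close>] by linarith
    finally show "norm (char (\<mu> n) t - char \<nu> t) < \<epsilon>" .
  qed
qed

lemma iexp_lipschitz: "cmod (iexp x - iexp y) \<le> \<bar>x - y\<bar>"
proof -
  have "iexp x - iexp y = iexp y * (iexp (x - y) - 1)"
    by (simp add: algebra_simps exp_add[symmetric] flip: exp_diff)
  then have "cmod (iexp x - iexp y) = cmod (iexp (x - y) - 1)" by (simp add: norm_mult)
  also have "\<dots> \<le> \<bar>x - y\<bar>" using iexp_approx1[of "x - y" 0] by simp
  finally show ?thesis .
qed

lemma char_symmetrized_law:
  assumes "g \<in> borel_measurable circle"
  shows "char (symmetrized_law g) t = (LINT \<theta>|circle. (iexp (t * cmod (g \<theta>)) + iexp (- (t * cmod (g \<theta>)))) / 2) / (2 * of_real pi)"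
  using integral_symmetrized_law[OF assms, of "\<lambda>x. iexp (t * x)" 1]
  by (simp add: char_def scaleR_conv_of_real)

text \<open>The limit law obeys the same \<open>L\<^sup>1\<close> bound as the eigenvalues, because \<open>exp(i t x)\<close> is Lipschitz in \<open>x\<close>
  with constant \<open>\<bar>t\<bar>\<close>.\<close>
lemma char_symmetrized_law_diff:
  assumes f: "integrable circle f" and g: "integrable circle g"
  shows "cmod (char (symmetrized_law f) t - char (symmetrized_law g) t) \<le> \<bar>t\<bar> * (LINT \<theta>|circle. cmod (f \<theta> - g \<theta>)) / (2 * pi)"
proof -
  let ?e = "\<lambda>f \<theta>. (iexp (t * cmod (f \<theta>)) + iexp (- (t * cmod (f \<theta>)))) / 2"
  have fm[measurable]: "f \<in> borel_measurable circle" "g \<in> borel_measurable circle" using f g by auto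
  have i: "integrable circle (?e h)" if [measurable]: "h \<in> borel_measurable circle" for h :: "real \<Rightarrow> complex"
  proof (rule circle.integrable_const_bound[of _ 1])
    show "AE x in circle. cmod (?e h x) \<le> 1"
    proof (rule AE_I2)
      fix x
      have "cmod (iexp (t * cmod (h x)) + iexp (- (t * cmod (h x)))) \<le> 1 + 1"
        by (rule order_trans[OF norm_triangle_ineq]) (simp only: norm_exp_i_times order_refl)
      then show "cmod (?e h x) \<le> 1" unfolding norm_divide by simp
    qed
  qed measurable
  have pw: "cmod (?e f \<theta> - ?e g \<theta>) \<le> \<bar>t\<bar> * cmod (f \<theta> - g \<theta>)" for \<theta>
  proof -
    have d: "\<bar>t * cmod (f \<theta>) - t * cmod (g \<theta>)\<bar> \<le> \<bar>t\<bar> * cmod (f \<theta> - g \<theta>)"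
      unfolding right_diff_distrib[symmetric] abs_mult by (intro mult_left_mono norm_triangle_ineq3) auto
    have "?e f \<theta> - ?e g \<theta> = ((iexp (t * cmod (f \<theta>)) - iexp (t * cmod (g \<theta>))) + (iexp (- (t * cmod (f \<theta>))) - iexp (- (t * cmod (g \<theta>))))) / 2"
      by (simp add: field_simps)
    also have "cmod \<dots> \<le> (cmod (iexp (t * cmod (f \<theta>)) - iexp (t * cmod (g \<theta>))) + cmod (iexp (- (t * cmod (f \<theta>))) - iexp (- (t * cmod (g \<theta>))))) / 2"
      unfolding norm_divide by (simp add: norm_triangle_ineq divide_right_mono)
    also have "\<dots> \<le> \<bar>t\<bar> * cmod (f \<theta> - g \<theta>)"
    proof -
      have eq: "\<bar>- (t * cmod (f \<theta>)) - - (t * cmod (g \<theta>))\<bar> = \<bar>t * cmod (f \<theta>) - t * cmod (g \<theta>)\<bar>"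
        by (simp add: abs_minus_commute)
      have "cmod (iexp (- (t * cmod (f \<theta>))) - iexp (- (t * cmod (g \<theta>)))) \<le> \<bar>t\<bar> * cmod (f \<theta> - g \<theta>)"
        by (rule order_trans[OF iexp_lipschitz]) (simp only: eq d)
      moreover have "cmod (iexp (t * cmod (f \<theta>)) - iexp (t * cmod (g \<theta>))) \<le> \<bar>t\<bar> * cmod (f \<theta> - g \<theta>)"
        by (rule order_trans[OF iexp_lipschitz d])
      moreover have "(a + b) / 2 \<le> c" if "a \<le> c" "b \<le> c" for a b c :: real
        using that by simp
      ultimately show ?thesis by blast
    qed
    finally show ?thesis .
  qed
  define I where "I = (LINT \<theta>|circle. ?e f \<theta> - ?e g \<theta>)"
  have I_eq: "I = (LINT \<theta>|circle. ?e f \<theta>) - (LINT \<theta>|circle. ?e g \<theta>)"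
    unfolding I_def by (rule Bochner_Integration.integral_diff[OF i[OF fm(1)] i[OF fm(2)]])
  have "cmod I \<le> (LINT \<theta>|circle. cmod (?e f \<theta> - ?e g \<theta>))"
    unfolding I_def by (rule integral_norm_bound)
  also have "\<dots> \<le> (LINT \<theta>|circle. \<bar>t\<bar> * cmod (f \<theta> - g \<theta>))"
    by (rule integral_mono[OF integrable_norm[OF Bochner_Integration.integrable_diff[OF i[OF fm(1)] i[OF fm(2)]]]
        integrable_mult_right[OF integrable_norm[OF Bochner_Integration.integrable_diff[OF f g]]] pw])
  also have "\<dots> = \<bar>t\<bar> * (LINT \<theta>|circle. cmod (f \<theta> - g \<theta>))"
    by (rule integral_mult_right_zero)
  finally have I_le: "cmod I \<le> \<bar>t\<bar> * (LINT \<theta>|circle. cmod (f \<theta> - g \<theta>))" .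
  have "char (symmetrized_law f) t - char (symmetrized_law g) t = I / (2 * of_real pi)"
    unfolding char_symmetrized_law[OF fm(1)] char_symmetrized_law[OF fm(2)] I_eq
    by (rule diff_divide_distrib[symmetric])
  then have "cmod (char (symmetrized_law f) t - char (symmetrized_law g) t) = cmod I / (2 * pi)"
    by (simp add: norm_divide norm_mult)
  then show ?thesis using I_le by (simp add: divide_right_mono)
qed

section \<open>Weak convergence of the eigenvalues\<close>

context band
begin

lemma symbol_norm_le: "cmod (symbol \<theta>) \<le> coeff_norm"
  unfolding symbol_def coeff_norm_def by (rule sum_norm_le) (simp add: norm_mult)

lemma symbol_integrable: "integrable circle symbol"
  by (rule continuous_integrable_circle[OF continuous_symbol])

lemma symbol_measurable: "symbol \<in> borel_measurable circle"
  by (rule continuous_measurable_circle[OF continuous_symbol])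

lemma fourier_coeff_symbol: "fourier_coeff symbol m = a m"
proof -
  have i: "integrable circle (\<lambda>\<theta>. a k * exp (\<i> * of_int k * of_real \<theta>) * exp (- \<i> * of_int m * of_real \<theta>))" for k
    by (intro continuous_integrable_circle continuous_intros)
  have "fourier_coeff symbol m = (\<Sum>k\<in>{- int b..int b}. fourier_coeff (\<lambda>\<theta>. a k * exp (\<i> * of_int k * of_real \<theta>)) m)"
    unfolding fourier_coeff_circle symbol_def sum_distrib_right
    by (simp only: Bochner_Integration.integral_sum i sum_distrib_left)
  also have "\<dots> = (\<Sum>k\<in>{- int b..int b}. if k = m then a m else 0)"
    by (intro sum.cong refl) (simp add: fourier_coeff_monomial)
  also have "\<dots> = a m" using band[of m] by auto
  finally show ?thesis .
qed

lemma symmetrized_law_power: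
  shows "integrable (symmetrized_law symbol) (\<lambda>x. x ^ k)"
    and "complex_of_real (LINT x|symmetrized_law symbol. x ^ k) = moment k"
    and "(LINT x|symmetrized_law symbol. x ^ (2 * m)) \<le> coeff_norm ^ (2 * m)"
proof -
  have bnd: "norm (cmod (symbol \<theta>) ^ j) \<le> coeff_norm ^ j" "norm ((- cmod (symbol \<theta>)) ^ j) \<le> coeff_norm ^ j" for \<theta> j
    using power_mono[OF symbol_norm_le norm_ge_zero, of \<theta> j] by (simp_all only: real_norm_def power_abs abs_minus_cancel abs_norm_cancel)
  have law: "integrable (symmetrized_law symbol) (\<lambda>x. x ^ j) \<and>
      (LINT x|symmetrized_law symbol. x ^ j)
      = (1 / (2 * pi)) *\<^sub>R (LINT \<theta>|circle. (1 / 2) *\<^sub>R (cmod (symbol \<theta>) ^ j + (- cmod (symbol \<theta>)) ^ j))" for j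
    by (rule integral_symmetrized_law[OF symbol_measurable _ bnd]) measurable
  show "integrable (symmetrized_law symbol) (\<lambda>x. x ^ k)" using law by blast
  show "complex_of_real (LINT x|symmetrized_law symbol. x ^ k) = moment k"
  proof (cases "even k")
    case True
    then obtain m where k: "k = 2 * m" by (elim evenE)
    have "complex_of_real (LINT x|symmetrized_law symbol. x ^ k) = of_real ((LINT \<theta>|circle. cmod (symbol \<theta>) ^ (2 * m)) / (2 * pi))"
      using law[of k] by (simp add: k)
    also have "\<dots> = moment k"
    proof -
      have "moment k = 1 / (2 * of_real pi) * (LINT \<theta>|circle. complex_of_real (cmod (symbol \<theta>) ^ (2 * m)))"
        by (simp add: moment_def k even_moment_coeff_def fourier_coeff_circle)
      then show ?thesis unfolding integral_complex_of_real by simp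
    qed
    finally show ?thesis .
  next
    case False
    then show ?thesis using law[of k] by (simp add: moment_def)
  qed
  interpret real_distribution "symmetrized_law symbol"
    by (rule real_distribution_symmetrized_law[OF symbol_measurable])
  have eq: "(LINT x|symmetrized_law symbol. x ^ (2 * m)) = (LINT \<theta>|circle. cmod (symbol \<theta>) ^ (2 * m)) / (2 * pi)"
    using law[of "2 * m"] by simp
  have le: "(LINT \<theta>|circle. cmod (symbol \<theta>) ^ (2 * m)) \<le> (LINT \<theta>|circle. coeff_norm ^ (2 * m))"
  proof (rule integral_mono)
    show "integrable circle (\<lambda>\<theta>. cmod (symbol \<theta>) ^ (2 * m))"
      using bnd(1)[of _ "2 * m"] symbol_measurable by (intro circle.integrable_const_bound[of _ "coeff_norm ^ (2 * m)"] AE_I2) auto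
    show "cmod (symbol \<theta>) ^ (2 * m) \<le> coeff_norm ^ (2 * m)" for \<theta>
      by (rule power_mono[OF symbol_norm_le norm_ge_zero])
  qed simp
  have const: "(LINT \<theta>|circle. coeff_norm ^ (2 * m)) = coeff_norm ^ (2 * m) * (2 * pi)"
    using measure_circle by simp
  show "(LINT x|symmetrized_law symbol. x ^ (2 * m)) \<le> coeff_norm ^ (2 * m)"
    unfolding eq using le unfolding const by (simp add: divide_le_eq)
qed

text \<open>For a trigonometric polynomial the error of \<open>trace_moment_bound\<close> is bounded, so division by the size
  of the matrix makes it disappear.\<close>
lemma char_empirical_law_symbol:
  assumes real: "\<And>k. a k \<in> \<real>"
    and sd: "\<And>n. spectral_decomposition (Suc n) (hankel_entry a (Suc n)) (d n) (q n)"
  shows "(\<lambda>n. char (empirical_law (Suc n) (d n)) t) \<longlonglongrightarrow> char (symmetrized_law symbol) t"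
proof (rule char_tendsto_of_moments)
  let ?E = "\<lambda>n k. LINT x|empirical_law (Suc n) (d n). x ^ k"
  show "real_distribution (empirical_law (Suc n) (d n))" for n by (rule real_distribution_empirical_law)
  show "real_distribution (symmetrized_law symbol)" by (rule real_distribution_symmetrized_law[OF symbol_measurable])
  show "integrable (empirical_law (Suc n) (d n)) (\<lambda>x. x ^ k)" for n k
    by (rule integral_empirical_law(1)) simp_all
  show "integrable (symmetrized_law symbol) (\<lambda>x. x ^ k)" for k by (rule symmetrized_law_power)
  show "(LINT x|symmetrized_law symbol. x ^ (2 * k)) \<le> coeff_norm ^ (2 * k)" for k by (rule symmetrized_law_power)
  have E: "complex_of_real (?E n k) = (\<Sum>i<Suc n. entry_power (Suc n) (hankel_entry a (Suc n)) k i i) / of_nat (Suc n)" for n k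
  proof -
    have "?E n k = (1 / real (Suc n)) *\<^sub>R (\<Sum>j<Suc n. d n j ^ k)"
      by (rule integral_empirical_law(2)) simp_all
    then show ?thesis unfolding trace_entry_power[OF sd]
      by (simp del: of_nat_Suc sum.lessThan_Suc of_real_sum of_real_power)
  qed
  show "?E n (2 * k) \<le> coeff_norm ^ (2 * k)" for n k
  proof -
    define T where "T = (\<Sum>i<Suc n. entry_power (Suc n) (hankel_entry a (Suc n)) (2 * k) i i)"
    have "cmod T \<le> (\<Sum>i<Suc n. coeff_norm ^ (2 * k))"
      unfolding T_def by (rule sum_norm_le) (rule entry_power_bound)
    then have "cmod T \<le> coeff_norm ^ (2 * k) * real (Suc n)"
      unfolding sum_constant card_lessThan by (simp only: mult.commute)
    then have "cmod T / real (Suc n) \<le> coeff_norm ^ (2 * k)"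
      by (subst pos_divide_le_eq) (simp_all del: of_nat_Suc)
    then have "cmod (complex_of_real (?E n (2 * k))) \<le> coeff_norm ^ (2 * k)"
      unfolding E T_def[symmetric] norm_divide norm_of_nat .
    then show ?thesis unfolding norm_of_real by (rule order_trans[OF abs_ge_self])
  qed
  show "(\<lambda>n. ?E n k) \<longlonglongrightarrow> (LINT x|symmetrized_law symbol. x ^ k)" for k
  proof -
    define K where "K = (2 * real (k * b) + 1) * (coeff_norm ^ k + cmod (moment k))"
    have le: "norm (?E n k - (LINT x|symmetrized_law symbol. x ^ k)) \<le> K / real (Suc n)" for n
    proof -
      define T where "T = (\<Sum>i<Suc n. entry_power (Suc n) (hankel_entry a (Suc n)) k i i)"
      have eq: "complex_of_real (?E n k) - moment k = (T - of_nat (Suc n) * moment k) / of_nat (Suc n)"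
        unfolding E T_def[symmetric] by (simp add: diff_divide_distrib del: of_nat_Suc)
      have "cmod (T - of_nat (Suc n) * moment k) \<le> K"
        unfolding K_def T_def by (rule trace_moment_bound[OF real])
      then have "cmod (complex_of_real (?E n k) - moment k) \<le> K / real (Suc n)"
        unfolding eq norm_divide norm_of_nat by (rule divide_right_mono) simp
      then show ?thesis
        unfolding symmetrized_law_power(2)[symmetric] of_real_diff[symmetric] norm_of_real real_norm_def .
    qed
    have "(\<lambda>n. K / real (Suc n)) \<longlonglongrightarrow> 0"
      using LIMSEQ_Suc[OF lim_const_over_n[of K]] .
    then have "(\<lambda>n. ?E n k - (LINT x|symmetrized_law symbol. x ^ k)) \<longlonglongrightarrow> 0"
      by (rule Lim_null_comparison[OF always_eventually[OF allI[OF le]]])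
    then show ?thesis by (rule LIM_zero_cancel)
  qed
qed

end

text \<open>The phase \<open>exp(-i (n - 1 - i - l) \<theta>)\<close> of a Hankel entry splits into a factor in \<open>i\<close> and a factor in
  \<open>l\<close>, which exhibits the difference of the two matrices as an average of rank one matrices.\<close>
lemma char_empirical_law_diff:
  assumes f: "integrable circle f" and g: "integrable circle g" and n: "n > 0"
    and d: "spectral_decomposition n (hankel_entry (fourier_coeff f) n) d q"
    and e: "spectral_decomposition n (hankel_entry (fourier_coeff g) n) e r"
  shows "cmod (char (empirical_law n d) t - char (empirical_law n e) t) \<le> \<bar>t\<bar> * (LINT \<theta>|circle. cmod (f \<theta> - g \<theta>)) / (2 * pi)"
proof -
  \<comment> \<open>The factor from the definition of the Fourier coefficients is absorbed into the weight.\<close>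
  define h where "h \<theta> = (f \<theta> - g \<theta>) / (2 * of_real pi)" for \<theta>
  define u where "u i \<theta> = exp (- \<i> * of_int (int n - 1 - int i) * of_real \<theta>)" for i :: nat and \<theta> :: real
  define v where "v l \<theta> = exp (\<i> * of_nat l * of_real \<theta>)" for l :: nat and \<theta> :: real
  have "cmod ((\<Sum>j<n. iexp (t * d j)) - (\<Sum>k<n. iexp (t * e k))) \<le> \<bar>t\<bar> * (n * (LINT \<theta>|circle. cmod (h \<theta>)))"
  proof (rule exp_trace_perturbation[OF d e])
    show "cmod (u i \<theta>) = 1" "cmod (v i \<theta>) = 1" for i \<theta> by (simp_all add: u_def v_def)
    show "u i \<in> borel_measurable circle" "v i \<in> borel_measurable circle" for i
      unfolding u_def v_def by (intro continuous_measurable_circle continuous_intros)+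
    show "integrable circle h" unfolding h_def using f g by simp
    fix i l
    have uv: "u i \<theta> * v l \<theta> = exp (- \<i> * of_int (int n - 1 - int i - int l) * of_real \<theta>)" for \<theta>
      unfolding u_def v_def exp_add[symmetric] by (simp add: algebra_simps)
    have "hankel_entry (fourier_coeff f) n i l - hankel_entry (fourier_coeff g) n i l
       = fourier_coeff (\<lambda>\<theta>. f \<theta> - g \<theta>) (int n - 1 - int i - int l)"
      by (simp add: hankel_entry_def fourier_coeff_diff[OF f g])
    then show "hankel_entry (fourier_coeff f) n i l - hankel_entry (fourier_coeff g) n i l = (LINT \<theta>|circle. h \<theta> * (u i \<theta> * v l \<theta>))"
      unfolding uv fourier_coeff_circle h_def by simp
  qed
  also have "(LINT \<theta>|circle. cmod (h \<theta>)) = (LINT \<theta>|circle. cmod (f \<theta> - g \<theta>)) / (2 * pi)"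
    by (simp add: h_def norm_divide norm_mult)
  finally have *: "cmod ((\<Sum>j<n. iexp (t * d j)) - (\<Sum>k<n. iexp (t * e k)))
      \<le> real n * (\<bar>t\<bar> * (LINT \<theta>|circle. cmod (f \<theta> - g \<theta>)) / (2 * pi))"
    by (simp add: mult_ac)
  have c: "char (empirical_law n d) t = (\<Sum>j<n. iexp (t * d j)) / of_nat n" for d
    unfolding char_def by (subst integral_empirical_law(2)[OF n]) (simp_all add: scaleR_conv_of_real)
  have "cmod (char (empirical_law n d) t - char (empirical_law n e) t) = cmod ((\<Sum>j<n. iexp (t * d j)) - (\<Sum>k<n. iexp (t * e k))) / n"
    unfolding c diff_divide_distrib[symmetric] norm_divide by simp
  also have "\<dots> \<le> real n * (\<bar>t\<bar> * (LINT \<theta>|circle. cmod (f \<theta> - g \<theta>)) / (2 * pi)) / n"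
    by (rule divide_right_mono[OF *]) simp
  finally show ?thesis using n by simp
qed

lemma hankel_entry_commute: "hankel_entry a n l i = hankel_entry a n i l"
  unfolding hankel_entry_def by (rule arg_cong[where f = a]) simp

lemma hankel_spectral_decomposition:
  assumes real: "\<And>k. a k \<in> \<real>"
    and A: "A = Matrix.mat n n (\<lambda>(i, l). hankel_entry a n i l)"
  obtains d q where "spectral_decomposition n (hankel_entry a n) d q"
    "eigenvalues_mset A = image_mset (\<lambda>j. of_real (d j)) (mset_set {..<n})"
    "singular_values A = image_mset (\<lambda>j. \<bar>d j\<bar>) (mset_set {..<n})"
proof -
  have Ac: "A \<in> carrier_mat n n" by (simp add: A)
  have "mat_adjoint A = A"
  proof (rule eq_matI)
    fix i l assume il: "i < dim_row A" "l < dim_col A"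
    have "cnj (hankel_entry a n l i) = hankel_entry a n l i"
      using real by (simp add: hankel_entry_def Reals_cnj_iff)
    also have "\<dots> = hankel_entry a n i l" by (rule hankel_entry_commute)
    finally show "mat_adjoint A $$ (i, l) = A $$ (i, l)" using il by (simp add: A)
  qed (simp_all add: A)
  from hermitian_spectral_decomposition[OF Ac this] obtain d q
    where "spectral_decomposition n (\<lambda>i l. A $$ (i, l)) d q"
    and e: "eigenvalues_mset A = image_mset (\<lambda>j. of_real (d j)) (mset_set {..<n})"
    "singular_values A = image_mset (\<lambda>j. \<bar>d j\<bar>) (mset_set {..<n})" by blast
  then have "spectral_decomposition n (hankel_entry a n) d q"
    by (simp add: spectral_decomposition_def A)
  then show thesis using that e by blast
qed

text \<open>Choose a Fejer mean within \<open>\<delta>\<close> of \<open>f\<close> in \<open>L\<^sup>1\<close>. The characteristic functions of the eigenvalues and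
  of the limit law each change by less than \<open>\<epsilon>/3\<close> when \<open>f\<close> is replaced by this mean, uniformly in the
  size of the matrix, and for the mean itself convergence is known.\<close>
theorem empirical_law_weak_conv:
  assumes f: "integrable circle f" and real: "\<And>k. fourier_coeff f k \<in> \<real>"
    and sd: "\<And>n. spectral_decomposition (Suc n) (hankel_entry (fourier_coeff f) (Suc n)) (d n) (q n)"
  shows "weak_conv_m (\<lambda>n. empirical_law (Suc n) (d n)) (symmetrized_law f)"
proof (rule levy_continuity)
  have fm: "f \<in> borel_measurable circle" using f by simp
  show "real_distribution (empirical_law (Suc n) (d n))" for n by (rule real_distribution_empirical_law)
  show "real_distribution (symmetrized_law f)" by (rule real_distribution_symmetrized_law[OF fm])
  fix t
  show "(\<lambda>n. char (empirical_law (Suc n) (d n)) t) \<longlonglongrightarrow> char (symmetrized_law f) t"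
  proof (rule LIMSEQ_I)
    fix \<epsilon> :: real assume \<epsilon>: "\<epsilon> > 0"
    \<comment> \<open>The summand 1 keeps the quotient meaningful for \<open>t = 0\<close>.\<close>
    define \<delta> where "\<delta> = \<epsilon> / (3 * (\<bar>t\<bar> + 1))"
    have \<delta>: "\<delta> > 0" using \<epsilon> by (simp add: \<delta>_def)
    obtain N where N: "N > 0" "(LINT x|circle. cmod (f x - fejer_mean N f x)) < \<delta>"
      using fejer_mean_L1_approx[OF f \<delta>] by blast
    define a where "a m = of_nat (diff_count N m) * fourier_coeff f m / of_nat N" for m
    interpret band a N unfolding a_def by (rule fejer_mean_eq_symbol)
    have sym: "fejer_mean N f = symbol" unfolding a_def by (rule fejer_mean_eq_symbol)
    have a_real: "a k \<in> \<real>" for k unfolding a_def using real by simp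
    have "\<exists>e r. spectral_decomposition (Suc n) (hankel_entry a (Suc n)) e r" for n
      by (rule hankel_spectral_decomposition[of a, OF a_real refl, of "Suc n"]) blast
    then obtain e r where er: "\<And>n. spectral_decomposition (Suc n) (hankel_entry a (Suc n)) (e n) (r n)"
      by metis
    have coeff: "fourier_coeff symbol = a" by (rule ext) (rule fourier_coeff_symbol)
    have er': "spectral_decomposition (Suc n) (hankel_entry (fourier_coeff symbol) (Suc n)) (e n) (r n)" for n
      unfolding coeff by (rule er)
    define D where "D = (LINT x|circle. cmod (f x - symbol x))"
    have small: "\<bar>t\<bar> * D / (2 * pi) < \<epsilon> / 3"
    proof -
      have "D \<ge> 0" by (simp add: D_def)
      have "\<bar>t\<bar> * D \<le> (\<bar>t\<bar> + 1) * \<delta>"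
        using N(2) \<open>D \<ge> 0\<close> by (intro mult_mono) (auto simp: D_def sym)
      also have "\<dots> = \<epsilon> / 3" by (simp add: \<delta>_def field_simps)
      finally have "\<bar>t\<bar> * D \<le> \<epsilon> / 3" .
      moreover have "\<bar>t\<bar> * D / (2 * pi) \<le> \<bar>t\<bar> * D / 2"
        using \<open>D \<ge> 0\<close> pi_gt3 by (intro divide_left_mono mult_nonneg_nonneg) auto
      ultimately show ?thesis using \<epsilon> by linarith
    qed
    from LIMSEQ_D[OF char_empirical_law_symbol[OF a_real er, of t], of "\<epsilon> / 3"] \<epsilon>
    obtain n0 where n0: "\<And>n. n \<ge> n0 \<Longrightarrow> cmod (char (empirical_law (Suc n) (e n)) t - char (symmetrized_law symbol) t) < \<epsilon> / 3"
      by auto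
    show "\<exists>n0. \<forall>n\<ge>n0. norm (char (empirical_law (Suc n) (d n)) t - char (symmetrized_law f) t) < \<epsilon>"
    proof (intro exI allI impI)
      fix n assume n: "n \<ge> n0"
      define x1 where "x1 = char (empirical_law (Suc n) (d n)) t"
      define x2 where "x2 = char (empirical_law (Suc n) (e n)) t"
      define x3 where "x3 = char (symmetrized_law symbol) t"
      define x4 where "x4 = char (symmetrized_law f) t"
      have "cmod (x1 - x2) < \<epsilon> / 3"
        unfolding x1_def x2_def
        by (rule order_le_less_trans[OF char_empirical_law_diff[OF f symbol_integrable zero_less_Suc sd er'] small[unfolded D_def]])
      moreover have "cmod (x2 - x3) < \<epsilon> / 3" using n0[OF n] unfolding x2_def x3_def .
      moreover have "cmod (x4 - x3) < \<epsilon> / 3"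
        unfolding x3_def x4_def
        by (rule order_le_less_trans[OF char_symmetrized_law_diff[OF f symbol_integrable] small[unfolded D_def]])
      moreover have "cmod (x1 - x4) \<le> cmod (x1 - x2) + cmod (x2 - x3) + cmod (x4 - x3)"
      proof -
        have "x1 - x4 = (x1 - x2) + (x2 - x3) - (x4 - x3)" by simp
        then show ?thesis
          using norm_triangle_ineq4[of "(x1 - x2) + (x2 - x3)" "x4 - x3"] norm_triangle_ineq[of "x1 - x2" "x2 - x3"]
          by simp
      qed
      ultimately have "cmod (x1 - x4) < \<epsilon>" by linarith
      then show "norm (char (empirical_law (Suc n) (d n)) t - char (symmetrized_law f) t) < \<epsilon>"
        unfolding x1_def x4_def .
    qed
  qed
qed

section \<open>Singular values and signs of the eigenvalues\<close>

lemma anti_identity_times_toeplitz: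
  "anti_identity_mat n * toeplitz_mat n f = Matrix.mat n n (\<lambda>(i, l). hankel_entry (fourier_coeff f) n i l)"
proof (rule eq_matI)
  fix i l
  assume "i < dim_row (Matrix.mat n n (\<lambda>(i, l). hankel_entry (fourier_coeff f) n i l))"
    "l < dim_col (Matrix.mat n n (\<lambda>(i, l). hankel_entry (fourier_coeff f) n i l))"
  then have il: "i < n" "l < n" by simp_all
  have "(anti_identity_mat n * toeplitz_mat n f) $$ (i, l)
     = (\<Sum>u<n. anti_identity_mat n $$ (i, u) * toeplitz_mat n f $$ (u, l))"
    by (rule index_mult_mat_sum[OF _ _ il]) (simp_all add: anti_identity_mat_def toeplitz_mat_def)
  also have "\<dots> = (\<Sum>u<n. if u = n - 1 - i then fourier_coeff f (int u - int l) else 0)"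
    by (intro sum.cong refl) (use il in \<open>auto simp: anti_identity_mat_def toeplitz_mat_def\<close>)
  also have "\<dots> = fourier_coeff f (int (n - 1 - i) - int l)"
    using il by simp
  also have "\<dots> = hankel_entry (fourier_coeff f) n i l"
    unfolding hankel_entry_def using il by (intro arg_cong[where f = "fourier_coeff f"]) (simp add: of_nat_diff)
  finally show "(anti_identity_mat n * toeplitz_mat n f) $$ (i, l)
     = Matrix.mat n n (\<lambda>(i, l). hankel_entry (fourier_coeff f) n i l) $$ (i, l)"
    using il by simp
qed (simp_all add: anti_identity_mat_def toeplitz_mat_def)

lemma real_symmetric_anti_identity_times_toeplitz:
  assumes "\<And>k. fourier_coeff f k \<in> \<real>"
  shows "real_symmetric_mat (anti_identity_mat n * toeplitz_mat n f)"
  unfolding real_symmetric_mat_def anti_identity_times_toeplitz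
proof
  show "elements_mat (Matrix.mat n n (\<lambda>(i, l). hankel_entry (fourier_coeff f) n i l)) \<subseteq> \<real>"
    using assms by (auto simp: elements_mat_def hankel_entry_def)
  show "transpose_mat (Matrix.mat n n (\<lambda>(i, l). hankel_entry (fourier_coeff f) n i l))
      = Matrix.mat n n (\<lambda>(i, l). hankel_entry (fourier_coeff f) n i l)"
    by (rule eq_matI) (simp_all add: hankel_entry_commute)
qed

lemma bounded_continuous_bounded_support:
  assumes "F \<in> continuous_bounded_support"
  obtains B where "\<And>x. cmod (F x) \<le> B"
proof -
  let ?S = "closure {x. F x \<noteq> 0}"
  have c: "continuous_on UNIV F" and bd: "bounded {x. F x \<noteq> 0}"
    using assms unfolding continuous_bounded_support_def by blast+
  have "compact (F ` ?S)"
    using bd by (intro compact_continuous_image continuous_on_subset[OF c subset_UNIV]) (simp only: compact_closure)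
  then have "bounded (F ` ?S)" by (rule compact_imp_bounded)
  then obtain B where "\<forall>y\<in>F ` ?S. cmod y \<le> B" unfolding bounded_iff by blast
  then have B: "cmod (F x) \<le> B" if "x \<in> ?S" for x using that by blast
  have "cmod (F x) \<le> max B 0" for x
  proof (cases "F x = 0")
    case False
    then have "x \<in> ?S" by (intro subsetD[OF closure_subset]) simp
    from B[OF this] show ?thesis by simp
  qed simp
  then show thesis by (rule that)
qed

lemma measure_symmetrized_law:
  assumes "g \<in> borel_measurable circle" and A: "A \<in> sets borel"
  shows "measure (symmetrized_law g) A
    = (1 / (2 * pi)) * (LINT \<theta>|circle. (indicator A (cmod (g \<theta>)) + indicator A (- cmod (g \<theta>))) / 2)"
proof -
  interpret real_distribution "symmetrized_law g"
    by (rule real_distribution_symmetrized_law[OF assms(1)])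
  have "measure (symmetrized_law g) A = (LINT x|symmetrized_law g. indicator A x)"
    using A by simp
  also have "\<dots> = (1 / (2 * pi)) *\<^sub>R (LINT \<theta>|circle. (1 / 2) *\<^sub>R (indicator A (cmod (g \<theta>)) + indicator A (- cmod (g \<theta>))))"
  proof (rule conjunct2[OF integral_symmetrized_law[OF assms(1), of _ 1]])
    show "indicator A \<in> borel_measurable borel" using A by (rule borel_measurable_indicator)
    show "norm (indicator A (cmod (g \<theta>)) :: real) \<le> 1" "norm (indicator A (- cmod (g \<theta>)) :: real) \<le> 1" for \<theta>
      by (simp_all add: indicator_def)
  qed
  finally show ?thesis unfolding real_scaleR_def by simp
qed

lemma symmetrized_law_half_lines:
  assumes "g \<in> borel_measurable circle"
  shows "measure (symmetrized_law g) {0<..} = measure (symmetrized_law g) {..<0}"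
  unfolding measure_symmetrized_law[OF assms greaterThan_borel] measure_symmetrized_law[OF assms lessThan_borel]
  by (intro arg_cong2[where f = "(*)"] refl Bochner_Integration.integral_cong) (auto simp: indicator_def)

text \<open>The atom at 0 carries the proportion of zeros of \<open>g\<close>.\<close>
lemma symmetrized_law_zero:
  assumes g: "g \<in> borel_measurable circle" and nz: "AE \<theta> in circle. g \<theta> \<noteq> 0"
  shows "emeasure (symmetrized_law g) {0} = 0"
proof -
  interpret real_distribution "symmetrized_law g"
    by (rule real_distribution_symmetrized_law[OF g])
  have "(LINT \<theta>|circle. (indicator {0} (cmod (g \<theta>)) + indicator {0} (- cmod (g \<theta>))) / 2) = (LINT \<theta>|circle. 0 :: real)"
    using nz g by (intro integral_cong_AE) (auto elim!: eventually_mono)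
  then have "measure (symmetrized_law g) {0} = 0"
    by (simp add: measure_symmetrized_law[OF g])
  then show ?thesis by (simp add: emeasure_eq_measure)
qed

lemma size_filter_image_mset_set:
  "finite A \<Longrightarrow> size (filter_mset P (image_mset h (mset_set A))) = card {j \<in> A. P (h j)}"
  by (simp add: filter_mset_image_mset)

theorem theorem4p1:
  fixes f :: "real \<Rightarrow> complex"
  assumes "set_integrable lebesgue {-pi..pi} f"
    and "\<forall>k::int. fourier_coeff f k \<in> \<real>"
  shows "sv_distributed (\<lambda>n. anti_identity_mat n * toeplitz_mat n f) f
    \<and> (\<forall>n>0. real_symmetric_mat (anti_identity_mat n * toeplitz_mat n f))
    \<and> (sparsely_vanishing f \<longrightarrow>
         (\<lambda>n. \<bar>real (num_pos_eigenvalues (anti_identity_mat n * toeplitz_mat n f))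
              - real (num_neg_eigenvalues (anti_identity_mat n * toeplitz_mat n f))\<bar>)
           \<in> o(\<lambda>n. real n))"
proof -
  define A where "A n = anti_identity_mat n * toeplitz_mat n f" for n
  have f: "integrable circle f"
    using assms(1) by (simp add: set_integrable_def integrable_restrict_space)
  then have fm: "f \<in> borel_measurable circle" by simp
  have real: "fourier_coeff f k \<in> \<real>" for k using assms(2) by blast
  have "\<exists>d q. spectral_decomposition n (hankel_entry (fourier_coeff f) n) d q \<and>
      eigenvalues_mset (A n) = image_mset (\<lambda>j. of_real (d j)) (mset_set {..<n}) \<and>
      singular_values (A n) = image_mset (\<lambda>j. \<bar>d j\<bar>) (mset_set {..<n})" for n
    by (rule hankel_spectral_decomposition[of "fourier_coeff f" "A n" n, OF real])
       (auto simp: A_def anti_identity_times_toeplitz)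
  then obtain d q where
    sd: "\<And>n. spectral_decomposition n (hankel_entry (fourier_coeff f) n) (d n) (q n)"
    and ev: "\<And>n. eigenvalues_mset (A n) = image_mset (\<lambda>j. of_real (d n j)) (mset_set {..<n})"
    and sv: "\<And>n. singular_values (A n) = image_mset (\<lambda>j. \<bar>d n j\<bar>) (mset_set {..<n})"
    by metis
  \<comment> \<open>There is no uniform distribution on the empty spectrum, so the sequence starts with size 1.\<close>
  define \<mu> where "\<mu> n = empirical_law (Suc n) (d (Suc n))" for n
  have \<mu>: "real_distribution (\<mu> n)" for n
    unfolding \<mu>_def by (rule real_distribution_empirical_law)
  have law: "real_distribution (symmetrized_law f)"
    by (rule real_distribution_symmetrized_law[OF fm])
  have weak: "weak_conv_m \<mu> (symmetrized_law f)"
    using empirical_law_weak_conv[OF f real sd] by (simp add: \<mu>_def[abs_def])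
  have "sv_distributed A f"
    unfolding sv_distributed_def
  proof (intro conjI allI impI ballI)
    show "A n \<in> carrier_mat n n" for n
      by (simp add: A_def anti_identity_times_toeplitz)
    show "set_borel_measurable lebesgue {-pi..pi} f"
      using assms(1) by (simp add: set_integrable_def set_borel_measurable_def)
    fix F assume F: "F \<in> continuous_bounded_support"
    then have Fc: "continuous_on UNIV F" by (simp add: continuous_bounded_support_def)
    obtain B where B: "\<And>x. cmod (F x) \<le> B" by (rule bounded_continuous_bounded_support[OF F]) blast
    have Fa: "continuous_on UNIV (\<lambda>x :: real. F \<bar>x\<bar>)"
      by (intro continuous_on_compose2[OF Fc] continuous_intros) auto
    then have Fm: "(\<lambda>x :: real. F \<bar>x\<bar>) \<in> borel_measurable borel"
      by (rule borel_measurable_continuous_onI)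
    have "(\<lambda>n. LINT x|\<mu> n. F \<bar>x\<bar>) \<longlonglongrightarrow> (LINT x|symmetrized_law f. F \<bar>x\<bar>)"
      by (rule weak_conv_imp_integral_bdd_continuous_conv[OF \<mu> law weak])
         (use Fa B in \<open>auto simp: continuous_on_eq_continuous_at\<close>)
    moreover have "(LINT x|\<mu> n. F \<bar>x\<bar>) = 1 / of_nat (Suc n) * (\<Sum>\<sigma>\<in>#singular_values (A (Suc n)). F \<sigma>)" for n
    proof -
      have "(LINT x|\<mu> n. F \<bar>x\<bar>) = (1 / real (Suc n)) *\<^sub>R (\<Sum>j<Suc n. F \<bar>d (Suc n) j\<bar>)"
        unfolding \<mu>_def by (rule integral_empirical_law(2)[OF _ Fm]) simp
      also have "(\<Sum>j<Suc n. F \<bar>d (Suc n) j\<bar>) = (\<Sum>\<sigma>\<in>#singular_values (A (Suc n)). F \<sigma>)"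
        unfolding sv sum_unfold_sum_mset image_mset.compositionality o_def ..
      finally show ?thesis by (simp add: scaleR_conv_of_real)
    qed
    moreover have "(LINT x|symmetrized_law f. F \<bar>x\<bar>) = 1 / (2 * of_real pi) * (LINT \<theta>:{-pi..pi}|lebesgue. F (cmod (f \<theta>)))"
    proof -
      have "(LINT x|symmetrized_law f. F \<bar>x\<bar>)
          = (1 / (2 * pi)) *\<^sub>R (LINT \<theta>|circle. (1 / 2) *\<^sub>R (F \<bar>cmod (f \<theta>)\<bar> + F \<bar>- cmod (f \<theta>)\<bar>))"
        using integral_symmetrized_law[OF fm Fm, of B] B by blast
      also have "(LINT \<theta>|circle. (1 / 2) *\<^sub>R (F \<bar>cmod (f \<theta>)\<bar> + F \<bar>- cmod (f \<theta>)\<bar>)) = (LINT \<theta>|circle. F (cmod (f \<theta>)))"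
        by (simp add: scaleR_conv_of_real)
      also have "\<dots> = (LINT \<theta>:{-pi..pi}|lebesgue. F (cmod (f \<theta>)))"
        unfolding set_lebesgue_integral_def by (subst integral_restrict_space) auto
      finally show ?thesis by (simp add: scaleR_conv_of_real)
    qed
    ultimately have "(\<lambda>n. 1 / of_nat (Suc n) * (\<Sum>\<sigma>\<in>#singular_values (A (Suc n)). F \<sigma>))
        \<longlonglongrightarrow> 1 / (2 * of_real pi) * (LINT \<theta>:{-pi..pi}|lebesgue. F (cmod (f \<theta>)))"
      by (simp only:)
    then show "(\<lambda>n. 1 / of_nat n * (\<Sum>\<sigma>\<in>#singular_values (A n). F \<sigma>))
        \<longlonglongrightarrow> 1 / (2 * of_real pi) * (LINT \<theta>:{-pi..pi}|lebesgue. F (cmod (f \<theta>)))"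
      by (rule LIMSEQ_imp_Suc)
  qed
  moreover have "(\<lambda>n. \<bar>real (num_pos_eigenvalues (A n)) - real (num_neg_eigenvalues (A n))\<bar>) \<in> o(\<lambda>n. real n)"
    if sparse: "sparsely_vanishing f"
  proof -
    have "AE \<theta> in lebesgue. \<theta> \<notin> {\<theta> \<in> {-pi..pi}. f \<theta> = 0}"
      using sparse by (intro AE_not_in) (simp add: sparsely_vanishing_def)
    then have "AE \<theta> in circle. f \<theta> \<noteq> 0"
      by (subst AE_restrict_space_iff) (auto elim!: eventually_mono)
    then have zero: "emeasure (symmetrized_law f) {0} = 0"
      by (rule symmetrized_law_zero[OF fm])
    have frontier: "frontier {0 :: real<..} = {0}" "frontier {..<0 :: real} = {0}"
      by (auto simp: frontier_def interior_open)
    have "(\<lambda>n. measure (\<mu> n) {0<..} - measure (\<mu> n) {..<0})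
        \<longlonglongrightarrow> measure (symmetrized_law f) {0<..} - measure (symmetrized_law f) {..<0}"
      by (intro tendsto_diff weak_conv_imp_continuity_set_conv[OF \<mu> law weak])
         (simp_all add: frontier zero)
    then have "(\<lambda>n. measure (\<mu> n) {0<..} - measure (\<mu> n) {..<0}) \<longlonglongrightarrow> 0"
      unfolding symmetrized_law_half_lines[OF fm] diff_self .
    then have lim: "(\<lambda>n. \<bar>measure (\<mu> n) {0<..} - measure (\<mu> n) {..<0}\<bar>) \<longlonglongrightarrow> 0"
      by (rule tendsto_rabs_zero)
    have eq: "\<bar>measure (\<mu> n) {0<..} - measure (\<mu> n) {..<0}\<bar>
        = \<bar>real (num_pos_eigenvalues (A (Suc n))) - real (num_neg_eigenvalues (A (Suc n)))\<bar> / real (Suc n)" for n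
    proof -
      have pos: "num_pos_eigenvalues (A (Suc n)) = card {j. j < Suc n \<and> d (Suc n) j \<in> {0<..}}"
        unfolding num_pos_eigenvalues_def ev size_filter_image_mset_set[OF finite_lessThan]
        by (rule arg_cong[where f = card]) auto
      have neg: "num_neg_eigenvalues (A (Suc n)) = card {j. j < Suc n \<and> d (Suc n) j \<in> {..<0}}"
        unfolding num_neg_eigenvalues_def ev size_filter_image_mset_set[OF finite_lessThan]
        by (rule arg_cong[where f = card]) auto
      show ?thesis
        unfolding \<mu>_def measure_empirical_law[OF zero_less_Suc greaterThan_borel]
          measure_empirical_law[OF zero_less_Suc lessThan_borel] pos neg diff_divide_distrib[symmetric] abs_divide
        by simp
    qed
    have "(\<lambda>n. \<bar>real (num_pos_eigenvalues (A n)) - real (num_neg_eigenvalues (A n))\<bar> / real n) \<longlonglongrightarrow> 0"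
      using lim unfolding eq by (rule LIMSEQ_imp_Suc)
    moreover have "\<forall>\<^sub>F n in sequentially. real n \<noteq> 0"
      by (rule eventually_sequentiallyI[of 1]) simp
    ultimately show ?thesis by (rule smalloI_tendsto)
  qed
  ultimately show ?thesis
    using real_symmetric_anti_identity_times_toeplitz[OF real] unfolding A_def by blast
qed

end
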